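(* Let $\kappa$ be a cardinal. The following are equivalent. (1) $\kappa < \mathfrak p$. (2) In a separable locally compact sober space the intersection of $\kappa$ or fewer open dense sets is non-empty. (3) In a separable core compact space, if $\mathcal{D}$ is a collection of $\kappa$ or fewer open dense sets, then there is an irreducible set meeting every member of $\mathcal{D}$. (4) In a $\sigma$-centered locally compact sober space the intersection of $\kappa$ or fewer open dense sets is non-empty. (5) In a $\sigma$-centered core compact space, if $\mathcal{D}$ is a collection of $\kappa$ or fewer open dense sets, then there is an irreducible set meeting every member of $\mathcal{D}$. (6) Let $\mathcal{L}$ be a downwards-$\sigma$-centered upwards-continuous distributive complete lattice. If $D$ is a set of $\kappa$ or fewer non-zero divisors of $\mathcal{L}$, then there is an irreducible $p \in \mathcal{L}$ such that no element of $D$ is below $p$ (i.e. no $d \in D$ satisfies $d \leq p$).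
   Context: Statements (2)-(6) are asserted for all spaces, respectively lattices, of the indicated kind. No separation axioms are assumed on topological spaces unless stated; "compact" does not include Hausdorff. The cardinal $\mathfrak p$: in a partially ordered set $(\mathcal{P},\leq)$ a set $R\subseteq\mathcal{P}$ is upwards-centered if every finite subset of $R$ has an upper bound in $\mathcal{P}$. $(\mathcal{P},\leq)$ is upwards-$\sigma$-centered if $\mathcal{P}$ is the union of countably many upwards-centered subsets. The cardinal $\mathfrak p$ is the least cardinal such that there exist a non-empty upwards-$\sigma$-centered partially ordered set $(\mathcal{P},\leq)$ and a collection $\{D_\alpha \mid \alpha < \mathfrak p\}$ of cofinal subsets of $\mathcal{P}$ such that no upwards-directed subset of $\mathcal{P}$ meets each $D_\alpha$. (By a theorem of Bell this agrees with the original definition of $\mathfrak p$ as the least cardinality of a family of subsets of $\omega$ all of whose finite subfamilies have infinite intersection but which has no infinite pseudo-intersection.) Topological spaces: A space is separable if it has a countable dense subset. A space $(X,\mathcal{T})$ is $\sigma$-centered if $\mathcal{T} - \{\emptyset\}$ with reverse inclusion is upwards-$\sigma$-centered. A space is locally compact if every open set contains a compact neighborhood of each of its points. For two sets $U, V$, write $U \ll V$ ($U$ is compact in $V$) if for every open cover of $V$ there is a finite subcollection which covers $U$. A space is core compact if every open set $O$ is the union of open sets $O'$ with $O' \ll O$. A subset $C$ of a space is irreducible if it is closed and the non-empty open sets in the subspace topology on $C$ form a filterbase (a non-empty family of non-empty sets such that the intersection of any two members contains a member). A space is sober if it is $T_0$ and every irreducible subset is the closure of a point. Lattices: In a partially ordered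 set $(\mathcal{P},\leq)$, $x$ is way below $y$, denoted $x \ll y$, if for any directed subset $E$ of $\mathcal{P}$ with supremum $\sup E$, if $y \leq \sup E$ then there is some $e \in E$ with $x \leq e$. $(\mathcal{P},\leq)$ is upwards-continuous if for all $y \in \mathcal{P}$ the set $\{x \in \mathcal{P} \mid x \ll y\}$ is a directed set with supremum $y$. A lattice is distributive if $a \wedge (b \vee c) = (a\wedge b)\vee(a \wedge c)$ and $a \vee (b \wedge c) = (a \vee b)\wedge(a\vee c)$ for all $a,b,c$. In a complete lattice, $0$ denotes the least element. A complete lattice $\mathcal{L}$ is downwards-$\sigma$-centered if $\mathcal{L} - \{0\}$ with order reversed is upwards-$\sigma$-centered. An element $x$ of a complete lattice is a non-zero divisor if $x \wedge y \neq 0$ for any $y \neq 0$. An element $x$ is irreducible if whenever $x = a \wedge b$ then $x = a$ or $x = b$.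
   Formalization: The spaces in (2)–(5) are taken to be non-empty and the lattice in (6) to have 0 ≠ 1, since (2)–(5) fail for the empty space and (6) fails for the one-point lattice when κ ≥ 1, even when κ < 𝔭. *)

theory Defs
  imports "HOL-Analysis.Analysis" "HOL-Algebra.Complete_Lattice"
begin

unbundle cardinal_syntax

text \<open>
  Directed sets are non-empty, as usual for the way-below relation: an empty directed set with
  supremum \<open>0\<close> would keep \<open>0\<close> from being way below itself.
\<close>

definition directed_in :: "'a gorder \<Rightarrow> 'a set \<Rightarrow> bool" where
  "directed_in P E \<longleftrightarrow> E \<subseteq> carrier P \<and> E \<noteq> {} \<and>
     (\<forall>x\<in>E. \<forall>y\<in>E. \<exists>z\<in>E. x \<sqsubseteq>\<^bsub>P\<^esub> z \<and> y \<sqsubseteq>\<^bsub>P\<^esub> z)"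

definition cofinal_in :: "'a gorder \<Rightarrow> 'a set \<Rightarrow> bool" where
  "cofinal_in P D \<longleftrightarrow> D \<subseteq> carrier P \<and> (\<forall>x\<in>carrier P. \<exists>d\<in>D. x \<sqsubseteq>\<^bsub>P\<^esub> d)"

definition upwards_centered_in :: "'a gorder \<Rightarrow> 'a set \<Rightarrow> bool" where
  "upwards_centered_in P R \<longleftrightarrow> R \<subseteq> carrier P \<and>
     (\<forall>F. finite F \<and> F \<subseteq> R \<longrightarrow> (\<exists>u\<in>carrier P. \<forall>x\<in>F. x \<sqsubseteq>\<^bsub>P\<^esub> u))"

definition upwards_sigma_centered :: "'a gorder \<Rightarrow> bool" where
  "upwards_sigma_centered P \<longleftrightarrow>
     (\<exists>\<R>. countable \<R> \<and> (\<forall>R\<in>\<R>. upwards_centered_in P R) \<and> \<Union>\<R> = carrier P)"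

definition has_unmet_cofinal_family :: "'p itself \<Rightarrow> 'k rel \<Rightarrow> bool" where
  "has_unmet_cofinal_family _ \<kappa> \<longleftrightarrow>
     (\<exists>(P :: 'p gorder) D. partial_order P \<and> carrier P \<noteq> {} \<and> upwards_sigma_centered P \<and>
        (\<forall>\<alpha>\<in>Field \<kappa>. cofinal_in P (D \<alpha>)) \<and>
        \<not> (\<exists>E. directed_in P E \<and> (\<forall>\<alpha>\<in>Field \<kappa>. E \<inter> D \<alpha> \<noteq> {})))"

text \<open>
  The least cardinal with \<^const>\<open>has_unmet_cofinal_family\<close> is determined only up to \<open>=o\<close>. It is
  at most the cardinality of the continuum, so it can be represented, and minimised over, on the
  type \<^typ>\<open>nat set\<close>.
\<close>

definition cardinal_p :: "'p itself \<Rightarrow> nat set rel" where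
  "cardinal_p T = (SOME \<pp>. Card_order \<pp> \<and> has_unmet_cofinal_family T \<pp> \<and>
     (\<forall>\<kappa> :: nat set rel. Card_order \<kappa> \<and> has_unmet_cofinal_family T \<kappa> \<longrightarrow> \<pp> \<le>o \<kappa>))"

text \<open>
  A formula cannot quantify over all types, so a statement about all partially ordered sets, all
  spaces or all lattices is made about those carried by subsets of an arbitrary type of at least
  the following size; every structure is isomorphic to one carried by such a type. The bound
  \<open>2\<close> to the power of the continuum leaves room for spaces and lattices built from the subsets of a
  partially ordered set of the size of the continuum.
\<close>

definition large_type :: "'u itself \<Rightarrow> bool" where
  "large_type _ \<longleftrightarrow> |UNIV :: nat set set set| \<le>o |UNIV :: 'u set|"

definition dense_in :: "'a topology \<Rightarrow> 'a set \<Rightarrow> bool" where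
  "dense_in X S \<longleftrightarrow> S \<subseteq> topspace X \<and> X closure_of S = topspace X"

definition sigma_centered_space :: "'a topology \<Rightarrow> bool" where
  "sigma_centered_space X \<longleftrightarrow> upwards_sigma_centered
     \<lparr>carrier = {U. openin X U \<and> U \<noteq> {}}, eq = (=), le = (\<lambda>U V. V \<subseteq> U)\<rparr>"

text \<open>
  This is stronger than \<^const>\<open>locally_compact_space\<close>, which asks for a single compact neighbourhood
  of each point; without separation axioms the two differ.
\<close>

definition locally_compact_base_space :: "'a topology \<Rightarrow> bool" where
  "locally_compact_base_space X \<longleftrightarrow> neighbourhood_base_of (compactin X) X"

definition compact_within :: "'a topology \<Rightarrow> 'a set \<Rightarrow> 'a set \<Rightarrow> bool" where
  "compact_within X U V \<longleftrightarrow>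
     (\<forall>\<C>. (\<forall>C\<in>\<C>. openin X C) \<and> V \<subseteq> \<Union>\<C> \<longrightarrow> (\<exists>\<F>\<subseteq>\<C>. finite \<F> \<and> U \<subseteq> \<Union>\<F>))"

definition core_compact_space :: "'a topology \<Rightarrow> bool" where
  "core_compact_space X \<longleftrightarrow>
     (\<forall>W. openin X W \<longrightarrow> W = \<Union>{V. openin X V \<and> compact_within X V W})"

definition is_filterbase :: "'a set set \<Rightarrow> bool" where
  "is_filterbase \<F> \<longleftrightarrow> \<F> \<noteq> {} \<and> {} \<notin> \<F> \<and> (\<forall>A\<in>\<F>. \<forall>B\<in>\<F>. \<exists>C\<in>\<F>. C \<subseteq> A \<inter> B)"

definition irreducible_in :: "'a topology \<Rightarrow> 'a set \<Rightarrow> bool" where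
  "irreducible_in X C \<longleftrightarrow>
     closedin X C \<and> is_filterbase {U. openin (subtopology X C) U \<and> U \<noteq> {}}"

definition sober_space :: "'a topology \<Rightarrow> bool" where
  "sober_space X \<longleftrightarrow> t0_space X \<and>
     (\<forall>C. irreducible_in X C \<longrightarrow> (\<exists>x\<in>topspace X. C = X closure_of {x}))"

definition way_below_in :: "'a gorder \<Rightarrow> 'a \<Rightarrow> 'a \<Rightarrow> bool" where
  "way_below_in P x y \<longleftrightarrow>
     (\<forall>E s. directed_in P E \<and> least P s (Upper P E) \<and> y \<sqsubseteq>\<^bsub>P\<^esub> s \<longrightarrow> (\<exists>e\<in>E. x \<sqsubseteq>\<^bsub>P\<^esub> e))"

definition upwards_continuous :: "'a gorder \<Rightarrow> bool" where
  "upwards_continuous P \<longleftrightarrow> (\<forall>y\<in>carrier P.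
     directed_in P {x \<in> carrier P. way_below_in P x y} \<and>
     least P y (Upper P {x \<in> carrier P. way_below_in P x y}))"

definition distributive_in :: "'a gorder \<Rightarrow> bool" where
  "distributive_in L \<longleftrightarrow> (\<forall>a\<in>carrier L. \<forall>b\<in>carrier L. \<forall>c\<in>carrier L.
     a \<sqinter>\<^bsub>L\<^esub> (b \<squnion>\<^bsub>L\<^esub> c) = (a \<sqinter>\<^bsub>L\<^esub> b) \<squnion>\<^bsub>L\<^esub> (a \<sqinter>\<^bsub>L\<^esub> c) \<and>
     a \<squnion>\<^bsub>L\<^esub> (b \<sqinter>\<^bsub>L\<^esub> c) = (a \<squnion>\<^bsub>L\<^esub> b) \<sqinter>\<^bsub>L\<^esub> (a \<squnion>\<^bsub>L\<^esub> c))"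

definition downwards_sigma_centered :: "'a gorder \<Rightarrow> bool" where
  "downwards_sigma_centered L \<longleftrightarrow>
     upwards_sigma_centered (inv_gorder (L\<lparr>carrier := carrier L - {\<bottom>\<^bsub>L\<^esub>}\<rparr>))"

definition non_zero_divisor :: "'a gorder \<Rightarrow> 'a \<Rightarrow> bool" where
  "non_zero_divisor L x \<longleftrightarrow> x \<in> carrier L \<and>
     (\<forall>y\<in>carrier L. y \<noteq> \<bottom>\<^bsub>L\<^esub> \<longrightarrow> x \<sqinter>\<^bsub>L\<^esub> y \<noteq> \<bottom>\<^bsub>L\<^esub>)"

definition irreducible_element :: "'a gorder \<Rightarrow> 'a \<Rightarrow> bool" where
  "irreducible_element L x \<longleftrightarrow> x \<in> carrier L \<and>
     (\<forall>a\<in>carrier L. \<forall>b\<in>carrier L. x = a \<sqinter>\<^bsub>L\<^esub> b \<longrightarrow> x = a \<or> x = b)"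

end

theory Submission
  imports Defs
begin

text \<open>
  Suppose \<open>\<kappa> < \<pp>\<close>. In a continuous lattice (or in the lattice of open sets of a core compact
  space) order the non-zero elements by \<open>y \<ll> x\<close>. This partial order is upwards \<open>\<sigma>\<close>-centered, and the
  non-zero elements way below a given non-zero divisor are cofinal, so \<open>\<kappa>\<close> of these sets are met by
  one directed set. It generates a Scott open proper filter containing the given non-zero divisors,
  and an element maximal outside that filter is irreducible and above none of them. That every
  poset may be used here, whatever its size, follows by a downward Loewenheim-Skolem argument.

  Conversely, let \<open>P\<close> and \<open>\<pp>\<close> many cofinal sets witness the definition of \<open>\<pp>\<close>, with \<open>P\<close> of size at
  most \<open>\<pp>\<close>. The lattice of upper sets of \<open>P\<close> refutes (6), since the complement of an irreducible
  upper set is directed. The space of upwards centered subsets of \<open>P\<close>, with the sets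
  \<open>{C. F \<subseteq> C}\<close> for finite \<open>F\<close> as a base, is separable, locally compact and sober, and refutes (2):
  \<open>\<pp>\<close> many dense open sets force \<open>C\<close> to meet the given cofinal sets and to be directed.
\<close>

subsection \<open>Cofinal families without a directed transversal\<close>

text \<open>Ordering by \<open>\<ll>\<close> instead of \<open>\<le>\<close> is what makes the
  generated filter Scott open: below each generator e there is another generator z with z way below
  e, so a chain whose supremum lies above e has a member above z. Suprema of chains outside the
  filter therefore stay outside, and Zorn's lemma applies. The obstacle is that \<open>\<ll>\<close>
  need not be reflexive: a set directed for its reflexive closure may end in an element with nothing
  in the set way below it. Such a set is prolonged by a descending sequence. In the converse
  direction the space gets one dense open set for each pair of elements of P, to force directedness;
  this is why P must be no larger than the cardinal. That the cardinal can be represented on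
  \<open>nat set\<close> comes from the finite binary strings, where one cofinal set for each subset
  of the natural numbers already excludes a directed transversal.\<close>

lemma upwards_sigma_centeredE:
  assumes "upwards_sigma_centered P"
  obtains \<R> where "countable \<R>" "\<And>R. R \<in> \<R> \<Longrightarrow> upwards_centered_in P R" "\<Union>\<R> = carrier P"
  using assms unfolding upwards_sigma_centered_def by (elim exE conjE) (erule that, rule bspec)

text \<open>Poset, index set and family are kept as parameters, with indices of any type, so that
  each can be shrunk or renamed on its own; \<open>has_unmet_cofinal_family\<close> is the case
  \<open>I = Field \<kappa>\<close> with the witnesses quantified away.\<close>

definition unmet_family :: "'p gorder \<Rightarrow> 'i set \<Rightarrow> ('i \<Rightarrow> 'p set) \<Rightarrow> bool" where
  "unmet_family P I D \<longleftrightarrow> partial_order P \<and> carrier P \<noteq> {} \<and> upwards_sigma_centered P \<and>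
     (\<forall>i\<in>I. cofinal_in P (D i)) \<and> \<not> (\<exists>E. directed_in P E \<and> (\<forall>i\<in>I. E \<inter> D i \<noteq> {}))"

lemma unmet_familyD:
  assumes "unmet_family P I D"
  shows "partial_order P" "carrier P \<noteq> {}" "upwards_sigma_centered P"
    "\<And>i. i \<in> I \<Longrightarrow> cofinal_in P (D i)"
    "\<And>E. directed_in P E \<Longrightarrow> \<exists>i\<in>I. E \<inter> D i = {}"
  using assms unfolding unmet_family_def by blast+

lemma has_unmet_cofinal_family_iff:
  "has_unmet_cofinal_family TYPE('p) \<kappa> \<longleftrightarrow> (\<exists>(P :: 'p gorder) D. unmet_family P (Field \<kappa>) D)"
  unfolding has_unmet_cofinal_family_def unmet_family_def by simp

section \<open>Small witnesses and their transport to other types\<close>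

lemma card_of_lists_of_length_ordLeq:
  fixes S :: "'a set"
  assumes "infinite K" "|S| \<le>o |K|"
  shows "|{xs. set xs \<subseteq> S \<and> length xs = n}| \<le>o |K|"
proof (induction n)
  case 0
  have "|{xs. set xs \<subseteq> S \<and> length xs = 0}| \<le>o |{[] :: 'a list}|"
    by (rule card_of_mono1) auto
  also have "|{[] :: 'a list}| \<le>o |K|"
    using assms(1) by (simp add: card_of_singl_ordLeq infinite_imp_nonempty)
  finally show ?case .
next
  case (Suc n)
  have "{xs. set xs \<subseteq> S \<and> length xs = Suc n}
      \<subseteq> (\<lambda>(x, xs). x # xs) ` (S \<times> {xs. set xs \<subseteq> S \<and> length xs = n})"
    by (auto simp: length_Suc_conv image_iff)
  hence "|{xs. set xs \<subseteq> S \<and> length xs = Suc n}| \<le>o |S \<times> {xs. set xs \<subseteq> S \<and> length xs = n}|"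
    by (meson card_of_image card_of_mono1 ordLeq_transitive)
  also have "|S \<times> {xs. set xs \<subseteq> S \<and> length xs = n}| \<le>o |K|"
    using assms Suc by (simp add: card_of_Sigma_ordLeq_infinite)
  finally show ?case .
qed

text \<open>A finite subset is the set of entries of a list, and each of the countably many lengths
  contributes at most \<open>|K|\<close> lists.\<close>

lemma card_of_finite_subsets_ordLeq:
  assumes "infinite K" "|S| \<le>o |K|"
  shows "|{F. finite F \<and> F \<subseteq> S}| \<le>o |K|"
proof -
  let ?L = "\<Union>n\<in>(UNIV::nat set). {xs. set xs \<subseteq> S \<and> length xs = n}"
  have "{F. finite F \<and> F \<subseteq> S} \<subseteq> set ` ?L"
    using finite_list by fastforce
  hence "|{F. finite F \<and> F \<subseteq> S}| \<le>o |?L|"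
    by (meson card_of_image card_of_mono1 ordLeq_transitive)
  also have "|?L| \<le>o |K|"
    using assms card_of_lists_of_length_ordLeq infinite_iff_card_of_nat
    by (intro card_of_UNION_ordLeq_infinite) blast+
  finally show ?thesis .
qed

text \<open>
  A downward Loewenheim-Skolem argument: close a point under Skolem functions for the cofinality of
  the \<open>D i\<close> and for upper bounds of finite sets.
\<close>

lemma unmet_family_small_subposet:
  fixes P :: "'q gorder" and K :: "'k set"
  assumes "unmet_family P I D" "infinite K" "|I| \<le>o |K|"
  obtains Q where "Q \<subseteq> carrier P" "|Q| \<le>o |K|"
    "unmet_family (P\<lparr>carrier := Q\<rparr>) I (\<lambda>i. D i \<inter> Q)"
proof -
  interpret partial_order P
    by (rule unmet_familyD(1)[OF assms(1)])
  obtain x0 where x0: "x0 \<in> carrier P"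
    using unmet_familyD(2)[OF assms(1)] by blast
  obtain \<R> where \<R>: "countable \<R>" "\<And>R. R \<in> \<R> \<Longrightarrow> upwards_centered_in P R" "\<Union>\<R> = carrier P"
    by (rule upwards_sigma_centeredE[OF unmet_familyD(3)[OF assms(1)]]) (rule that)
  have cof: "\<And>i. i \<in> I \<Longrightarrow> cofinal_in P (D i)"
    by (rule unmet_familyD(4)[OF assms(1)])
  define f where "f i x = (SOME d. d \<in> D i \<and> x \<sqsubseteq>\<^bsub>P\<^esub> d)" for i x
  have f: "f i x \<in> D i \<and> x \<sqsubseteq>\<^bsub>P\<^esub> f i x" if "i \<in> I" "x \<in> carrier P" for i x
    unfolding f_def by (rule someI_ex) (use cof[OF that(1)] that(2) in \<open>auto simp: cofinal_in_def\<close>)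
  \<comment> \<open>A bound in P of a finite part of \<open>R \<inter> Q\<close> may lie outside Q.
    Closing Q under \<open>b\<close> supplies one inside, so that \<open>R \<inter> Q\<close> is
    centered in Q itself. Unbounded F are filtered out by \<open>bdd\<close>, because
    \<open>b F\<close> is arbitrary for them.\<close>
  define bdd where "bdd F \<longleftrightarrow> (\<exists>u\<in>carrier P. \<forall>x\<in>F. x \<sqsubseteq>\<^bsub>P\<^esub> u)" for F
  define b where "b F = (SOME u. u \<in> carrier P \<and> (\<forall>x\<in>F. x \<sqsubseteq>\<^bsub>P\<^esub> u))" for F
  have b: "b F \<in> carrier P \<and> (\<forall>x\<in>F. x \<sqsubseteq>\<^bsub>P\<^esub> b F)" if "bdd F" for F
    unfolding b_def by (rule someI_ex) (use that in \<open>auto simp: bdd_def\<close>)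
  have fc: "\<And>i x. i \<in> I \<Longrightarrow> x \<in> carrier P \<Longrightarrow> f i x \<in> carrier P"
    using f cof unfolding cofinal_in_def by blast
  define step where
    "step S = S \<union> ((\<lambda>(i, x). f i x) ` (I \<times> S) \<union> b ` {F. (finite F \<and> F \<subseteq> S) \<and> bdd F})" for S
  define S where "S n = (step ^^ n) {x0}" for n
  define Q where "Q = (\<Union>n. S n)"
  have S_Suc: "S (Suc n) = step (S n)" for n
    by (simp add: S_def)
  have S_carrier: "S n \<subseteq> carrier P" for n
  proof (induction n)
    case 0
    show ?case using x0 by (simp add: S_def)
  next
    case (Suc n)
    thus ?case unfolding S_Suc step_def using fc b by (auto simp: subset_iff)
  qed
  have S_card: "|S n| \<le>o |K|" for n
  proof (induction n)
    case 0
    show ?case using assms(2)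
      by (simp add: S_def card_of_singl_ordLeq infinite_imp_nonempty)
  next
    case (Suc n)
    have "|I \<times> S n| \<le>o |K|"
      using assms(2,3) Suc by (simp add: card_of_Sigma_ordLeq_infinite)
    hence 1: "|(\<lambda>(i, x). f i x) ` (I \<times> S n)| \<le>o |K|"
      using card_of_image ordLeq_transitive by blast
    have "|b ` {F. (finite F \<and> F \<subseteq> S n) \<and> bdd F}| \<le>o |{F. (finite F \<and> F \<subseteq> S n) \<and> bdd F}|"
      by (rule card_of_image)
    also have "|{F. (finite F \<and> F \<subseteq> S n) \<and> bdd F}| \<le>o |{F. finite F \<and> F \<subseteq> S n}|"
      by (rule card_of_mono1) auto
    also have "|{F. finite F \<and> F \<subseteq> S n}| \<le>o |K|"
      by (rule card_of_finite_subsets_ordLeq[OF assms(2) Suc])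
    finally show ?case
      unfolding S_Suc step_def using assms(2) 1 Suc
      by (intro card_of_Un_ordLeq_infinite_Field card_of_Card_order) (simp_all add: Field_card_of)
  qed
  have S_mono: "m \<le> n \<Longrightarrow> S m \<subseteq> S n" for m n
    by (rule lift_Suc_mono_le) (auto simp: S_Suc step_def)
  have Qc: "Q \<subseteq> carrier P"
    unfolding Q_def using S_carrier by blast
  have "x0 \<in> Q"
    unfolding Q_def by (auto simp: S_def intro: exI[of _ 0])
  have Qcard: "|Q| \<le>o |K|"
    unfolding Q_def using assms(2) S_card infinite_iff_card_of_nat
    by (intro card_of_UNION_ordLeq_infinite) blast+
  have Qf: "f i x \<in> Q" if "i \<in> I" "x \<in> Q" for i x
  proof -
    from that obtain n where "x \<in> S n" unfolding Q_def by blast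
    hence "f i x \<in> S (Suc n)"
      unfolding S_Suc step_def using that(1) by (auto simp: image_iff)
    thus ?thesis unfolding Q_def by blast
  qed
  have Qb: "b F \<in> Q" if F: "finite F" "F \<subseteq> Q" "bdd F" for F
  proof -
    have "\<exists>n. F \<subseteq> S n"
      using F(1,2)
    proof (induction F)
      case (insert x F)
      then obtain m n where "F \<subseteq> S n" "x \<in> S m" unfolding Q_def by blast
      hence "insert x F \<subseteq> S (max m n)"
        using S_mono[of m "max m n"] S_mono[of n "max m n"] by auto
      thus ?case ..
    qed simp
    then obtain n where "F \<subseteq> S n" ..
    hence "b F \<in> S (Suc n)"
      unfolding S_Suc step_def using F by blast
    thus ?thesis unfolding Q_def by blast
  qed
  let ?Q = "P\<lparr>carrier := Q\<rparr>"
  have "partial_order ?Q"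
    using weak_partial_order_subset[OF weak_partial_order_axioms Qc] eq_is_equal
    by (simp add: partial_order_def partial_order_axioms_def)
  moreover have "upwards_sigma_centered ?Q"
    unfolding upwards_sigma_centered_def
  proof (intro exI conjI ballI)
    show "countable ((\<lambda>R. R \<inter> Q) ` \<R>)" using \<R>(1) by simp
    show "\<Union>((\<lambda>R. R \<inter> Q) ` \<R>) = carrier ?Q" using \<R>(3) Qc by auto
    fix R' assume "R' \<in> (\<lambda>R. R \<inter> Q) ` \<R>"
    then obtain R where R: "R \<in> \<R>" "R' = R \<inter> Q" by blast
    have "\<exists>u\<in>Q. \<forall>x\<in>F. x \<sqsubseteq>\<^bsub>P\<^esub> u" if "finite F" "F \<subseteq> R'" for F
    proof -
      have "bdd F"
        using \<R>(2)[OF R(1)] that R(2) unfolding bdd_def upwards_centered_in_def by blast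
      thus ?thesis using Qb[of F] b that R(2) by blast
    qed
    thus "upwards_centered_in ?Q R'"
      unfolding upwards_centered_in_def using R(2) by auto
  qed
  moreover have "cofinal_in ?Q (D i \<inter> Q)" if "i \<in> I" for i
    unfolding cofinal_in_def
  proof (intro conjI ballI)
    fix x assume x: "x \<in> carrier ?Q"
    hence "x \<in> carrier P" using Qc by auto
    with x show "\<exists>d\<in>D i \<inter> Q. x \<sqsubseteq>\<^bsub>?Q\<^esub> d"
      using f[OF that] Qf[OF that] by (intro bexI[of _ "f i x"]) auto
  qed simp
  moreover have "\<not> (\<exists>E. directed_in ?Q E \<and> (\<forall>i\<in>I. E \<inter> (D i \<inter> Q) \<noteq> {}))"
  proof
    assume "\<exists>E. directed_in ?Q E \<and> (\<forall>i\<in>I. E \<inter> (D i \<inter> Q) \<noteq> {})"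
    then obtain E where E: "directed_in ?Q E" "\<forall>i\<in>I. E \<inter> (D i \<inter> Q) \<noteq> {}" by blast
    have "directed_in P E" using E(1) Qc by (auto simp: directed_in_def)
    moreover have "\<forall>i\<in>I. E \<inter> D i \<noteq> {}" using E(2) by blast
    ultimately show False using unmet_familyD(5)[OF assms(1)] by blast
  qed
  ultimately have "unmet_family ?Q I (\<lambda>i. D i \<inter> Q)"
    unfolding unmet_family_def using \<open>x0 \<in> Q\<close> by (intro conjI) (blast | simp; blast)+
  with Qc Qcard show thesis using that by blast
qed

lemma unmet_family_transport:
  fixes P :: "'q gorder" and I :: "'i set" and J :: "'j set"
  assumes "unmet_family P I D" "|carrier P| \<le>o |UNIV :: 'p set|" "|I| \<le>o |J|"
  obtains P' :: "'p gorder" and D' where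
    "unmet_family P' J D'" "|carrier P'| \<le>o |carrier P|"
proof -
  interpret partial_order P
    by (rule unmet_familyD(1)[OF assms(1)])
  obtain g :: "'q \<Rightarrow> 'p" where g: "inj_on g (carrier P)"
    using assms(2) by (auto simp: card_of_ordLeq[symmetric])
  obtain h where h: "inj_on h I" "h ` I \<subseteq> J"
    using assms(3) by (auto simp: card_of_ordLeq[symmetric])
  define k where "k = inv_into (carrier P) g"
  have kg: "k (g x) = x" if "x \<in> carrier P" for x
    unfolding k_def using g that by simp
  define P' :: "'p gorder" where
    "P' = \<lparr>carrier = g ` carrier P, eq = (=), le = (\<lambda>x y. k x \<sqsubseteq>\<^bsub>P\<^esub> k y)\<rparr>"
  have sel: "carrier P' = g ` carrier P" "eq P' = (=)" "le P' = (\<lambda>x y. k x \<sqsubseteq>\<^bsub>P\<^esub> k y)"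
    by (simp_all add: P'_def)
  define D' where "D' j = g ` (if j \<in> h ` I then D (inv_into I h j) else carrier P)" for j
  have cof: "\<And>i. i \<in> I \<Longrightarrow> cofinal_in P (D i)"
    by (rule unmet_familyD(4)[OF assms(1)])
  have "partial_order P'"
  proof unfold_locales
    fix x y assume "x \<sqsubseteq>\<^bsub>P'\<^esub> y" "y \<sqsubseteq>\<^bsub>P'\<^esub> x" "x \<in> carrier P'" "y \<in> carrier P'"
    moreover from this obtain a b where "a \<in> carrier P" "b \<in> carrier P" "x = g a" "y = g b"
      by (auto simp: sel)
    ultimately show "x .=\<^bsub>P'\<^esub> y"
      using le_antisym[of a b] by (simp add: sel kg)
  qed (auto simp: sel kg intro: le_trans)
  moreover have "carrier P' \<noteq> {}"
    using unmet_familyD(2)[OF assms(1)] by (simp add: sel)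
  moreover have "upwards_sigma_centered P'"
  proof -
    obtain \<R> where \<R>: "countable \<R>" "\<And>R. R \<in> \<R> \<Longrightarrow> upwards_centered_in P R" "\<Union>\<R> = carrier P"
      by (rule upwards_sigma_centeredE[OF unmet_familyD(3)[OF assms(1)]]) (rule that)
    have "upwards_centered_in P' (g ` R)" if R: "R \<in> \<R>" for R
      unfolding upwards_centered_in_def
    proof (intro conjI allI impI)
      have Rc: "R \<subseteq> carrier P" using \<R>(3) that by blast
      thus "g ` R \<subseteq> carrier P'" by (auto simp: sel)
      fix F assume "finite F \<and> F \<subseteq> g ` R"
      then obtain F' where F': "finite F'" "F' \<subseteq> R" "F = g ` F'"
        by (meson finite_subset_image)
      obtain u where "u \<in> carrier P" "\<forall>x\<in>F'. x \<sqsubseteq>\<^bsub>P\<^esub> u"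
        using \<R>(2)[OF R] F'(1,2) unfolding upwards_centered_in_def by blast
      thus "\<exists>u\<in>carrier P'. \<forall>x\<in>F. x \<sqsubseteq>\<^bsub>P'\<^esub> u"
        using F' Rc by (intro bexI[of _ "g u"]) (auto simp: sel kg subset_iff)
    qed
    thus ?thesis
      unfolding upwards_sigma_centered_def using \<R>(1,3)
      by (intro exI[of _ "(`) g ` \<R>"]) (auto simp: sel image_Union[symmetric])
  qed
  moreover have "cofinal_in P' (D' j)" if "j \<in> J" for j
  proof (cases "j \<in> h ` I")
    case True
    then obtain i where i: "i \<in> I" "j = h i" by blast
    hence D': "D' j = g ` D i" using h(1) by (simp add: D'_def)
    show ?thesis
      unfolding cofinal_in_def
    proof (intro conjI ballI)
      have c: "D i \<subseteq> carrier P" using cof[OF i(1)] unfolding cofinal_in_def by blast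
      thus "D' j \<subseteq> carrier P'" unfolding D' sel by blast
      fix x assume "x \<in> carrier P'"
      then obtain a where a: "a \<in> carrier P" "x = g a" by (auto simp: sel)
      then obtain d where "d \<in> D i" "a \<sqsubseteq>\<^bsub>P\<^esub> d" using cof[OF i(1)] unfolding cofinal_in_def by blast
      moreover from this have "d \<in> carrier P" using c by blast
      ultimately show "\<exists>d\<in>D' j. x \<sqsubseteq>\<^bsub>P'\<^esub> d"
        unfolding D' by (intro bexI[of _ "g d"]) (auto simp: sel a kg)
    qed
  next
    case False
    thus ?thesis unfolding cofinal_in_def by (auto simp: D'_def sel kg)
  qed
  moreover have "\<not> (\<exists>E. directed_in P' E \<and> (\<forall>j\<in>J. E \<inter> D' j \<noteq> {}))"
  proof
    assume "\<exists>E. directed_in P' E \<and> (\<forall>j\<in>J. E \<inter> D' j \<noteq> {})"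
    then obtain E where E: "directed_in P' E" "\<forall>j\<in>J. E \<inter> D' j \<noteq> {}" by blast
    have "directed_in P (k ` E)"
      unfolding directed_in_def
    proof (intro conjI ballI)
      show "k ` E \<subseteq> carrier P" "k ` E \<noteq> {}"
        using E(1) by (auto simp: directed_in_def sel kg)
      fix x y assume "x \<in> k ` E" "y \<in> k ` E"
      then obtain a b where "a \<in> E" "x = k a" "b \<in> E" "y = k b" by blast
      thus "\<exists>z\<in>k ` E. x \<sqsubseteq>\<^bsub>P\<^esub> z \<and> y \<sqsubseteq>\<^bsub>P\<^esub> z"
        using E(1) by (simp add: directed_in_def sel)
    qed
    moreover have "k ` E \<inter> D i \<noteq> {}" if i: "i \<in> I" for i
    proof -
      have "D' (h i) = g ` D i" using h(1) i by (simp add: D'_def)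
      moreover have "E \<inter> D' (h i) \<noteq> {}" using E(2) h(2) i by blast
      ultimately obtain d where "d \<in> D i" "g d \<in> E" by auto
      moreover have "d \<in> carrier P"
        using cof[OF i] \<open>d \<in> D i\<close> unfolding cofinal_in_def by blast
      ultimately show ?thesis using kg by (metis IntI empty_iff imageI)
    qed
    ultimately show False using unmet_familyD(5)[OF assms(1)] by blast
  qed
  ultimately have "unmet_family P' J D'"
    unfolding unmet_family_def by blast
  moreover have "|carrier P'| \<le>o |carrier P|"
    by (simp add: sel card_of_image)
  ultimately show thesis using that by blast
qed

section \<open>The cardinal is infinite and at most the continuum\<close>

text \<open>Climb into the sets one after another. They need not be closed upwards, so the final
  \<open>u\<close> is only above a member of each; passing to the elements below \<open>u\<close>
  recovers these members.\<close>

lemma finite_family_met: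
  assumes "partial_order P" "x \<in> carrier P" "finite I" "\<And>i. i \<in> I \<Longrightarrow> cofinal_in P (D i)"
  shows "\<exists>u\<in>carrier P. x \<sqsubseteq>\<^bsub>P\<^esub> u \<and> (\<forall>i\<in>I. \<exists>d\<in>D i. d \<sqsubseteq>\<^bsub>P\<^esub> u)"
proof -
  interpret partial_order P by fact
  show ?thesis
    using assms(3,4)
  proof (induction I)
    case empty
    thus ?case using assms(2) by auto
  next
    case (insert i I)
    then obtain u where u: "u \<in> carrier P" "x \<sqsubseteq>\<^bsub>P\<^esub> u" "\<forall>i\<in>I. \<exists>d\<in>D i. d \<sqsubseteq>\<^bsub>P\<^esub> u" by blast
    have c: "\<And>j. j \<in> insert i I \<Longrightarrow> D j \<subseteq> carrier P"
      using insert.prems unfolding cofinal_in_def by blast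
    obtain d where d: "d \<in> D i" "u \<sqsubseteq>\<^bsub>P\<^esub> d"
      using insert.prems[of i] u(1) unfolding cofinal_in_def by blast
    have dc: "d \<in> carrier P" using c d(1) by blast
    have "\<exists>e\<in>D j. e \<sqsubseteq>\<^bsub>P\<^esub> d" if j: "j \<in> insert i I" for j
    proof (cases "j = i")
      case True
      thus ?thesis using d(1) dc by blast
    next
      case False
      then obtain e where e: "e \<in> D j" "e \<sqsubseteq>\<^bsub>P\<^esub> u" using u(3) j by blast
      hence "e \<in> carrier P" using c[OF j] by blast
      hence "e \<sqsubseteq>\<^bsub>P\<^esub> d" using le_trans[OF e(2) d(2) _ u(1) dc] by blast
      thus ?thesis using e(1) by blast
    qed
    moreover have "x \<sqsubseteq>\<^bsub>P\<^esub> d" by (rule le_trans[OF u(2) d(2) assms(2) u(1) dc])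
    ultimately show ?case using dc by blast
  qed
qed

text \<open>Otherwise the principal down-set of a suitable \<open>u\<close> is a directed
  transversal. Infinity of the index set is what permits cardinal arithmetic with pairs and finite
  subsets.\<close>

lemma unmet_family_infinite:
  assumes "unmet_family P I D"
  shows "infinite I"
proof
  assume fin: "finite I"
  interpret partial_order P
    by (rule unmet_familyD(1)[OF assms])
  have cof: "\<And>i. i \<in> I \<Longrightarrow> cofinal_in P (D i)"
    by (rule unmet_familyD(4)[OF assms])
  obtain x where x: "x \<in> carrier P"
    using unmet_familyD(2)[OF assms] by blast
  obtain u where u: "u \<in> carrier P" "\<forall>i\<in>I. \<exists>d\<in>D i. d \<sqsubseteq>\<^bsub>P\<^esub> u"
    using finite_family_met[where D = D, OF partial_order_axioms x fin cof] by auto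
  let ?E = "{y \<in> carrier P. y \<sqsubseteq>\<^bsub>P\<^esub> u}"
  have "directed_in P ?E"
    unfolding directed_in_def using u(1) by auto
  then obtain i where i: "i \<in> I" "?E \<inter> D i = {}"
    using unmet_familyD(5)[OF assms] by blast
  obtain d where d: "d \<in> D i" "d \<sqsubseteq>\<^bsub>P\<^esub> u"
    using u(2) i(1) by auto
  moreover have "d \<in> carrier P"
    using cof[OF i(1)] d(1) by (auto simp: cofinal_in_def)
  ultimately show False using i(2) by auto
qed

text \<open>This is the Cohen poset of finite binary strings, countable and hence the union of its
  centered singletons. The set for A consists of the strings that already disagree with the
  characteristic function of A. A directed set of strings describes a single partial function, and A
  can be chosen to agree with it.\<close>

lemma prefixes_unmet_family:
  "unmet_family \<lparr>carrier = UNIV, eq = (=), le = (\<lambda>s t. \<exists>r. t = s @ r)\<rparr> (UNIV :: nat set set)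
     (\<lambda>A. {s. \<exists>i<length s. s ! i \<noteq> (i \<in> A)})"
  (is "unmet_family ?P _ ?D")
proof -
  have "partial_order ?P"
    by unfold_locales auto
  moreover have "upwards_sigma_centered ?P"
    unfolding upwards_sigma_centered_def
  proof (intro exI conjI ballI)
    show "countable (range (\<lambda>s::bool list. {s}))" by simp
    show "\<Union>(range (\<lambda>s::bool list. {s})) = carrier ?P" by auto
    fix R assume "R \<in> range (\<lambda>s::bool list. {s})"
    then obtain s where s: "R = {s}" by blast
    show "upwards_centered_in ?P R"
      unfolding upwards_centered_in_def
    proof (intro conjI allI impI)
      fix F assume "finite F \<and> F \<subseteq> R"
      thus "\<exists>u\<in>carrier ?P. \<forall>x\<in>F. x \<sqsubseteq>\<^bsub>?P\<^esub> u"
        using s by (intro bexI[of _ s]) auto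
    qed simp
  qed
  moreover have "cofinal_in ?P (?D A)" for A
    unfolding cofinal_in_def
  proof (intro conjI ballI)
    fix s :: "bool list"
    \<comment> \<open>The appended bit sits at position \<open>length s\<close> and is wrong for A
      there.\<close>
    have "s @ [length s \<notin> A] \<in> ?D A" by (auto intro!: exI[of _ "length s"])
    thus "\<exists>d\<in>?D A. s \<sqsubseteq>\<^bsub>?P\<^esub> d"
      by (rule bexI[rotated]) simp
  qed simp
  moreover have "\<not> (\<exists>E. directed_in ?P E \<and> (\<forall>A\<in>UNIV. E \<inter> ?D A \<noteq> {}))"
  proof
    assume "\<exists>E. directed_in ?P E \<and> (\<forall>A\<in>UNIV. E \<inter> ?D A \<noteq> {})"
    then obtain E where E: "directed_in ?P E" "\<And>A. E \<inter> ?D A \<noteq> {}" by blast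
    have compat: "s ! i = t ! i" if "s \<in> E" "t \<in> E" "i < length s" "i < length t" for s t i
    proof -
      obtain z where "z \<in> E" "\<exists>r. z = s @ r" "\<exists>r. z = t @ r"
        using E(1) \<open>s \<in> E\<close> \<open>t \<in> E\<close> unfolding directed_in_def by simp metis
      thus ?thesis using that(3,4) by (metis nth_append)
    qed
    \<comment> \<open>The set read off from E itself: by \<open>compat\<close>, no member of E can
      disagree with it.\<close>
    let ?A = "{i. \<exists>t\<in>E. i < length t \<and> t ! i}"
    obtain s i where "s \<in> E" "i < length s" "s ! i \<noteq> (i \<in> ?A)"
      using E(2)[of ?A] by auto
    thus False using compat[of s _ i] by blast
  qed
  ultimately show ?thesis unfolding unmet_family_def by simp
qed

lemma large_type_nat_set_set:
  assumes "large_type TYPE('u)"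
  shows "|UNIV :: nat set set set| \<le>o |UNIV :: 'u set|"
  using assms by (simp add: large_type_def)

lemma large_type_nat_set:
  assumes "large_type TYPE('u)"
  shows "|UNIV :: nat set set| \<le>o |UNIV :: 'u set|"
proof -
  have "|UNIV :: nat set set| \<le>o |UNIV :: nat set set set|"
    using card_of_Pow[of "UNIV :: nat set set"] ordLess_imp_ordLeq by auto
  thus ?thesis using large_type_nat_set_set[OF assms] ordLeq_transitive by blast
qed

lemma infinite_nat_set: "infinite (UNIV :: nat set set)"
  by (simp add: Finite_Set.finite_set)

text \<open>The \<open>SOME\<close> in the definition is meaningful: the binary strings, moved to
  the type \<open>'p\<close>, show that \<open>|UNIV :: nat set set|\<close> has the property, and
  well-foundedness of cardinals yields a least one.\<close>

lemma cardinal_p_spec: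
  assumes "large_type TYPE('p)"
  shows "Card_order (cardinal_p TYPE('p))"
    and "has_unmet_cofinal_family TYPE('p) (cardinal_p TYPE('p))"
    and "\<And>\<kappa> :: nat set rel. Card_order \<kappa> \<Longrightarrow> has_unmet_cofinal_family TYPE('p) \<kappa> \<Longrightarrow>
           cardinal_p TYPE('p) \<le>o \<kappa>"
proof -
  let ?C = "{\<kappa> :: nat set rel. Card_order \<kappa> \<and> has_unmet_cofinal_family TYPE('p) \<kappa>}"
  have "|UNIV :: bool list set| \<le>o |UNIV :: nat set|"
    by (meson card_of_ordLeq countableI_type countable_def subset_UNIV)
  also have "|UNIV :: nat set| \<le>o |UNIV :: nat set set|"
    using infinite_iff_card_of_nat infinite_nat_set by blast
  also have "|UNIV :: nat set set| \<le>o |UNIV :: 'p set|"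
    by (rule large_type_nat_set[OF assms])
  finally have "|UNIV :: bool list set| \<le>o |UNIV :: 'p set|" .
  hence "|carrier \<lparr>carrier = UNIV :: bool list set, eq = (=), le = (\<lambda>s t. \<exists>r. t = s @ r)\<rparr>|
      \<le>o |UNIV :: 'p set|"
    by simp
  from unmet_family_transport[OF prefixes_unmet_family this card_of_refl[THEN ordIso_imp_ordLeq]]
  obtain P' :: "'p gorder" and D' :: "nat set \<Rightarrow> 'p set" where "unmet_family P' UNIV D'" .
  hence "|UNIV :: nat set set| \<in> ?C"
    by (auto simp: has_unmet_cofinal_family_iff Field_card_of card_of_card_order_on)
  then obtain \<pp> where "\<pp> \<in> ?C" "\<forall>\<kappa>\<in>?C. \<pp> \<le>o \<kappa>"
    using exists_minim_Card_order[of ?C] by blast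
  hence "Card_order \<pp> \<and> has_unmet_cofinal_family TYPE('p) \<pp> \<and>
     (\<forall>\<kappa> :: nat set rel. Card_order \<kappa> \<and> has_unmet_cofinal_family TYPE('p) \<kappa> \<longrightarrow> \<pp> \<le>o \<kappa>)"
    by simp
  hence ex: "\<exists>\<pp> :: nat set rel. Card_order \<pp> \<and> has_unmet_cofinal_family TYPE('p) \<pp> \<and>
     (\<forall>\<kappa> :: nat set rel. Card_order \<kappa> \<and> has_unmet_cofinal_family TYPE('p) \<kappa> \<longrightarrow> \<pp> \<le>o \<kappa>)"
    by (rule exI)
  have spec: "Card_order (cardinal_p TYPE('p)) \<and>
     has_unmet_cofinal_family TYPE('p) (cardinal_p TYPE('p)) \<and>
     (\<forall>\<kappa> :: nat set rel. Card_order \<kappa> \<and> has_unmet_cofinal_family TYPE('p) \<kappa> \<longrightarrow>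
        cardinal_p TYPE('p) \<le>o \<kappa>)"
    unfolding cardinal_p_def by (rule someI_ex[OF ex])
  show "Card_order (cardinal_p TYPE('p))"
    using spec by (rule conjunct1)
  show "has_unmet_cofinal_family TYPE('p) (cardinal_p TYPE('p))"
    using spec by (elim conjE)
  show "cardinal_p TYPE('p) \<le>o \<kappa>"
    if "Card_order \<kappa>" "has_unmet_cofinal_family TYPE('p) \<kappa>" for \<kappa> :: "nat set rel"
    using spec that by simp
qed

section \<open>The cardinal for posets and index sets of arbitrary types\<close>

text \<open>A failure could be cut down to a poset of at most continuum size, which fits into
  \<open>'p\<close>, with its indices renamed into \<open>nat set\<close>. There it would contradict
  minimality.\<close>

lemma cofinal_family_met:
  fixes P :: "'q gorder" and I :: "'i set"
  assumes "large_type TYPE('p)" "|I| <o cardinal_p TYPE('p)"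
    and "partial_order P" "carrier P \<noteq> {}" "upwards_sigma_centered P"
    and "\<And>i. i \<in> I \<Longrightarrow> cofinal_in P (D i)"
  obtains E where "directed_in P E" "\<And>i. i \<in> I \<Longrightarrow> E \<inter> D i \<noteq> {}"
proof (rule ccontr)
  assume "\<not> thesis"
  hence unmet: "unmet_family P I D"
    unfolding unmet_family_def using assms that by blast
  \<comment> \<open>Minimality speaks only about cardinals on \<open>nat set\<close>. As
    \<open>cardinal_p\<close> is one of them, a smaller index set embeds into that type.\<close>
  have "|I| \<le>o |UNIV :: nat set set|"
  proof -
    have "|Field (cardinal_p TYPE('p))| =o cardinal_p TYPE('p)"
      by (rule card_of_Field_ordIso[OF cardinal_p_spec(1)[OF assms(1)]])
    hence "|I| \<le>o |Field (cardinal_p TYPE('p))|"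
      using ordLess_imp_ordLeq[OF ordLess_ordIso_trans[OF assms(2) ordIso_symmetric]] by blast
    thus ?thesis using ordLeq_transitive[OF _ card_of_mono1[OF subset_UNIV]] by blast
  qed
  then obtain g :: "'i \<Rightarrow> nat set" where g: "inj_on g I"
    by (auto simp: card_of_ordLeq[symmetric])
  have iso: "|I| =o |g ` I|"
    using g card_of_ordIso[of I "g ` I"] by (auto simp: bij_betw_def)
  obtain Q where Q: "|Q| \<le>o |UNIV :: nat set set|"
    "unmet_family (P\<lparr>carrier := Q\<rparr>) I (\<lambda>i. D i \<inter> Q)"
    using unmet_family_small_subposet[OF unmet infinite_nat_set \<open>|I| \<le>o |UNIV :: nat set set|\<close>]
    by blast
  have "|carrier (P\<lparr>carrier := Q\<rparr>)| \<le>o |UNIV :: 'p set|"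
    using ordLeq_transitive[OF Q(1) large_type_nat_set[OF assms(1)]] by simp
  from unmet_family_transport[OF Q(2) this ordIso_imp_ordLeq[OF iso]]
  obtain P' :: "'p gorder" and D' where "unmet_family P' (g ` I) D'" .
  hence "has_unmet_cofinal_family TYPE('p) |g ` I|"
    unfolding has_unmet_cofinal_family_iff by (auto simp: Field_card_of)
  hence "cardinal_p TYPE('p) \<le>o |g ` I|"
    using cardinal_p_spec(3)[OF assms(1)] card_of_Card_order by blast
  moreover have "|g ` I| <o cardinal_p TYPE('p)"
    by (rule ordIso_ordLess_trans[OF ordIso_symmetric[OF iso] assms(2)])
  ultimately show False
    using not_ordLess_ordLeq by metis
qed

text \<open>The witness is shrunk relative to its own index set, so the poset becomes no larger than
  the cardinal. It is then placed on \<open>nat set\<close>, so that its subsets have the type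
  \<open>nat set set\<close>, which embeds into every large type.\<close>

lemma cardinal_p_unmet_family:
  assumes "large_type TYPE('p)"
  obtains P :: "nat set gorder" and J :: "nat set set" and D where
    "unmet_family P J D" "|carrier P| \<le>o |J|" "|J| =o cardinal_p TYPE('p)" "infinite J"
proof -
  let ?J = "Field (cardinal_p TYPE('p))"
  obtain P0 :: "'p gorder" and D0 where P0: "unmet_family P0 ?J D0"
    using cardinal_p_spec(2)[OF assms] unfolding has_unmet_cofinal_family_iff by blast
  have inf: "infinite ?J" by (rule unmet_family_infinite[OF P0])
  have refl: "|?J| \<le>o |?J|" by (rule ordIso_imp_ordLeq[OF card_of_refl])
  obtain Q where Q: "|Q| \<le>o |?J|" "unmet_family (P0\<lparr>carrier := Q\<rparr>) ?J (\<lambda>i. D0 i \<inter> Q)"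
    using unmet_family_small_subposet[OF P0 inf refl] by blast
  have "|carrier (P0\<lparr>carrier := Q\<rparr>)| \<le>o |UNIV :: nat set set|"
    using ordLeq_transitive[OF Q(1) card_of_mono1[OF subset_UNIV]] by simp
  from unmet_family_transport[OF Q(2) this refl]
  obtain P :: "nat set gorder" and D where
    P: "unmet_family P ?J D" "|carrier P| \<le>o |carrier (P0\<lparr>carrier := Q\<rparr>)|" .
  have "|carrier P| \<le>o |?J|"
    using ordLeq_transitive[OF P(2)] Q(1) by simp
  from that[OF P(1) this card_of_Field_ordIso[OF cardinal_p_spec(1)[OF assms]] inf]
  show thesis .
qed

subsection \<open>Filters for the way-below relation\<close>

text \<open>The common core for spaces and lattices, with \<open>w\<close> standing for
  \<open>\<ll>\<close> on non-zero elements. The conclusion asks for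
  \<open>w z x \<and> w z y\<close> without the alternative of equality, which is more than
  directedness for the reflexive closure gives. This strictness later yields Scott openness.\<close>

lemma way_below_filter:
  fixes Q :: "'q set" and w :: "'q \<Rightarrow> 'q \<Rightarrow> bool" and I :: "'i set"
  assumes "large_type TYPE('p)" "|I| <o cardinal_p TYPE('p)" "Q \<noteq> {}"
    and trans: "\<And>x y z. x \<in> Q \<Longrightarrow> y \<in> Q \<Longrightarrow> z \<in> Q \<Longrightarrow> w x y \<Longrightarrow> w y z \<Longrightarrow> w x z"
    and antisym: "\<And>x y. x \<in> Q \<Longrightarrow> y \<in> Q \<Longrightarrow> w x y \<Longrightarrow> w y x \<Longrightarrow> x = y"
    and \<R>: "countable \<R>" "\<Union>\<R> = Q"
      "\<And>R F. R \<in> \<R> \<Longrightarrow> finite F \<Longrightarrow> F \<subseteq> R \<Longrightarrow> \<exists>u\<in>Q. \<forall>x\<in>F. w u x"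
    and A: "\<And>i x. i \<in> I \<Longrightarrow> x \<in> Q \<Longrightarrow> \<exists>y\<in>Q. w y x \<and> A i y"
  obtains E where "E \<subseteq> Q" "E \<noteq> {}" "\<And>x y. x \<in> E \<Longrightarrow> y \<in> E \<Longrightarrow> \<exists>z\<in>E. w z x \<and> w z y"
    "\<And>i. i \<in> I \<Longrightarrow> \<exists>y\<in>E. A i y"
proof -
  \<comment> \<open>The order is reversed, so climbing means shrinking, and equality is added
    because \<open>w\<close> may fail to be reflexive.\<close>
  define P :: "'q gorder" where "P = \<lparr>carrier = Q, eq = (=), le = (\<lambda>x y. x = y \<or> w y x)\<rparr>"
  have sel: "carrier P = Q" "eq P = (=)" "le P = (\<lambda>x y. x = y \<or> w y x)"
    by (simp_all add: P_def)
  have po: "partial_order P"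
    by unfold_locales (auto simp: sel dest: antisym trans)
  have "upwards_centered_in P R" if R: "R \<in> \<R>" for R
    unfolding upwards_centered_in_def
  proof (intro conjI allI impI)
    show "R \<subseteq> carrier P" using R \<R>(2) by (auto simp: sel)
    fix F assume F: "finite F \<and> F \<subseteq> R"
    obtain u where "u \<in> Q" "\<forall>x\<in>F. w u x" using \<R>(3)[OF R, of F] F by auto
    thus "\<exists>u\<in>carrier P. \<forall>x\<in>F. x \<sqsubseteq>\<^bsub>P\<^esub> u"
      by (intro bexI[of _ u]) (simp_all add: sel)
  qed
  hence sc: "upwards_sigma_centered P"
    unfolding upwards_sigma_centered_def using \<R>(1,2) by (intro exI[of _ \<R>]) (simp add: sel)
  have "cofinal_in P {y \<in> Q. A i y}" if i: "i \<in> I" for i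
    unfolding cofinal_in_def
  proof (intro conjI ballI)
    fix x assume "x \<in> carrier P"
    then obtain y where "y \<in> Q" "w y x" "A i y" using A[OF i, of x] by (auto simp: sel)
    thus "\<exists>d\<in>{y \<in> Q. A i y}. x \<sqsubseteq>\<^bsub>P\<^esub> d"
      by (intro bexI[of _ y]) (simp_all add: sel)
  qed (auto simp: sel)
  moreover have "carrier P \<noteq> {}" using assms(3) by (simp add: sel)
  ultimately obtain E where E: "directed_in P E" "\<And>i. i \<in> I \<Longrightarrow> E \<inter> {y \<in> Q. A i y} \<noteq> {}"
    using cofinal_family_met[OF assms(1,2) po _ sc, of "\<lambda>i. {y \<in> Q. A i y}"] by metis
  have EQ: "E \<subseteq> Q" "E \<noteq> {}"
    using E(1) by (auto simp: directed_in_def sel)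
  have dir: "\<exists>z\<in>E. (x = z \<or> w z x) \<and> (y = z \<or> w z y)" if "x \<in> E" "y \<in> E" for x y
    using E(1) that by (simp add: directed_in_def sel)
  show thesis
  \<comment> \<open>Without a last element, every x in E has a y that is neither x nor above it in
    the sense of \<open>w\<close>, and a common refinement of x and y is then strictly beyond x.
    With a last element \<open>e\<close>, the set has to be extended.\<close>
  proof (cases "\<exists>e\<in>E. \<forall>x\<in>E. x = e \<or> w e x")
    case False
    have strict: "\<exists>z\<in>E. w z x" if x: "x \<in> E" for x
    proof -
      obtain y where y: "y \<in> E" "y \<noteq> x" "\<not> w x y" using False x by blast
      obtain z where "z \<in> E" "x = z \<or> w z x" "y = z \<or> w z y" using dir[OF x y(1)] by blast
      thus ?thesis using y by blast
    qed
    show thesis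
    proof (rule that[OF EQ])
      fix x y assume "x \<in> E" "y \<in> E"
      then obtain z where z: "z \<in> E" "x = z \<or> w z x" "y = z \<or> w z y" using dir[of x y] by blast
      obtain z' where "z' \<in> E" "w z' z" using strict[OF z(1)] by blast
      moreover have "w z' x" "w z' y"
        using trans[of z' z x] trans[of z' z y] z \<open>z' \<in> E\<close> \<open>w z' z\<close> EQ(1) \<open>x \<in> E\<close> \<open>y \<in> E\<close>
        by blast+
      ultimately show "\<exists>z\<in>E. w z x \<and> w z y" by blast
    next
      fix i assume "i \<in> I"
      thus "\<exists>y\<in>E. A i y" using E(2)[of i] by blast
    qed
  next
    case True
    then obtain e where e: "e \<in> E" "\<forall>x\<in>E. x = e \<or> w e x" by blast
    \<comment> \<open>The hypothesis on centered sets, applied to singletons, lets one descend from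
      any element; iterating from \<open>e\<close> gives the sequence \<open>d\<close>.\<close>
    have "\<exists>y. y \<in> Q \<and> w y x" if x: "x \<in> Q" for x
    proof -
      obtain R where R: "R \<in> \<R>" "x \<in> R" using \<R>(2) x by blast
      show ?thesis using \<R>(3)[OF R(1), of "{x}"] R(2) by auto
    qed
    then obtain s where s: "\<And>x. x \<in> Q \<Longrightarrow> s x \<in> Q \<and> w (s x) x" by metis
    define d where "d n = (s ^^ n) e" for n
    have dQ: "d n \<in> Q" for n
      by (induction n) (use e(1) EQ(1) s in \<open>auto simp: d_def\<close>)
    have d_less: "w (d (Suc n + m)) (d m)" for n m
    proof (induction n)
      case 0
      show ?case using s[OF dQ[of m]] by (simp add: d_def)
    next
      case (Suc n)
      have "w (d (Suc (Suc n) + m)) (d (Suc n + m))"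
        using s[OF dQ[of "Suc n + m"]] by (simp add: d_def)
      thus ?case using trans[OF dQ dQ dQ _ Suc] by blast
    qed
    \<comment> \<open>All late terms of \<open>d\<close> lie below a given element. For members of E
      the bound is 1 and not 0, since \<open>d 0 = e\<close> and \<open>w e e\<close> may
      fail.\<close>
    have below: "\<exists>n. \<forall>m\<ge>n. w (d m) x" if x: "x \<in> E \<union> range d" for x
    proof (cases "x \<in> E")
      case True
      have 1: "w (d m) e" if m: "m \<ge> 1" for m
        using d_less[of "m - 1" 0] m by (simp add: d_def)
      have "w (d m) x" if m: "m \<ge> 1" for m
      proof (cases "x = e")
        case False
        hence "w e x" using e(2) True by blast
        thus ?thesis using trans[OF dQ _ _ 1[OF m], of x] e(1) EQ(1) True by blast
      qed (use 1[OF m] in simp)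
      thus ?thesis by blast
    next
      case False
      then obtain k where k: "x = d k" using x by blast
      have "w (d m) x" if m: "m \<ge> Suc k" for m
        using d_less[of "m - Suc k" k] m k by simp
      thus ?thesis by blast
    qed
    show thesis
    proof (rule that[of "E \<union> range d"])
      show "E \<union> range d \<subseteq> Q" "E \<union> range d \<noteq> {}" using EQ dQ by auto
      fix x y assume "x \<in> E \<union> range d" "y \<in> E \<union> range d"
      then obtain m n where mn: "\<forall>l\<ge>m. w (d l) x" "\<forall>l\<ge>n. w (d l) y" using below by meson
      show "\<exists>z\<in>E \<union> range d. w z x \<and> w z y"
        using mn by (intro bexI[of _ "d (max m n)"]) auto
    next
      fix i assume "i \<in> I"
      thus "\<exists>y\<in>E \<union> range d. A i y" using E(2)[of i] by blast
    qed
  qed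
qed

section \<open>Core compact spaces\<close>

lemma compact_within_subset:
  assumes "compact_within X V W" "openin X W"
  shows "V \<subseteq> W"
proof -
  obtain \<F> where "\<F> \<subseteq> {W}" "V \<subseteq> \<Union>\<F>"
    using assms unfolding compact_within_def by (elim allE[of _ "{W}"]) auto
  thus ?thesis by blast
qed

lemma compact_within_mono:
  assumes "compact_within X V W" "V' \<subseteq> V" "W \<subseteq> W'"
  shows "compact_within X V' W'"
  unfolding compact_within_def
proof (intro allI impI)
  fix \<C> assume \<C>: "(\<forall>C\<in>\<C>. openin X C) \<and> W' \<subseteq> \<Union>\<C>"
  hence "W \<subseteq> \<Union>\<C>" using assms(3) by blast
  then obtain \<F> where "\<F> \<subseteq> \<C>" "finite \<F>" "V \<subseteq> \<Union>\<F>"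
    using assms(1) \<C> unfolding compact_within_def by meson
  thus "\<exists>\<F>\<subseteq>\<C>. finite \<F> \<and> V' \<subseteq> \<Union>\<F>" using assms(2) by blast
qed

lemma core_compact_interpolate:
  assumes "core_compact_space X" "openin X W" "W \<noteq> {}"
  obtains V where "openin X V" "V \<noteq> {}" "compact_within X V W"
proof -
  have "W = \<Union>{V. openin X V \<and> compact_within X V W}"
    using assms(1,2) unfolding core_compact_space_def by blast
  thus thesis using assms(3) that by blast
qed

text \<open>The complement of M is irreducible because M is a prime open set: an intersection of two
  open sets lies in M only if one of them does. It meets each given U because U belongs to the
  filter F, and an open superset of U, unlike M, would too.\<close>

lemma core_compact_baire:
  fixes X :: "'b topology"
  assumes "large_type TYPE('p)" "|\<D>| <o cardinal_p TYPE('p)"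
    and "topspace X \<noteq> {}" "sigma_centered_space X" "core_compact_space X"
    and \<D>: "\<And>U. U \<in> \<D> \<Longrightarrow> openin X U" "\<And>U. U \<in> \<D> \<Longrightarrow> dense_in X U"
  obtains C where "irreducible_in X C" "\<And>U. U \<in> \<D> \<Longrightarrow> C \<inter> U \<noteq> {}"
proof -
  let ?Q = "{U. openin X U \<and> U \<noteq> {}}"
  obtain \<R> where \<R>: "countable \<R>" "\<Union>\<R> = ?Q"
    "\<And>R. R \<in> \<R> \<Longrightarrow>
      upwards_centered_in \<lparr>carrier = ?Q, eq = (=), le = (\<lambda>U V. V \<subseteq> U)\<rparr> R"
    using assms(4) unfolding sigma_centered_space_def
    by (elim upwards_sigma_centeredE) (rule that, simp_all)
  have "topspace X \<in> ?Q" using assms(3) by auto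
  hence ne: "?Q \<noteq> {}" by blast
  have tr: "compact_within X U W"
    if "U \<in> ?Q" "V \<in> ?Q" "W \<in> ?Q" "compact_within X U V" "compact_within X V W" for U V W
    using that compact_within_subset[of X V W] compact_within_mono[of X U V U W] by auto
  have an: "U = V"
    if "U \<in> ?Q" "V \<in> ?Q" "compact_within X U V" "compact_within X V U" for U V
    using that compact_within_subset[of X U V] compact_within_subset[of X V U] by auto
  have sg: "\<exists>u\<in>?Q. \<forall>x\<in>F. compact_within X u x"
    if R: "R \<in> \<R>" and F: "finite F" "F \<subseteq> R" for R F
  proof -
    obtain u where u: "u \<in> ?Q" "\<forall>x\<in>F. u \<subseteq> x"
      using \<R>(3)[OF R] F unfolding upwards_centered_in_def by simp meson
    \<comment> \<open>Centeredness bounds F only for inclusion; one more shrinking makes the bound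
      strict.\<close>
    obtain V where V: "openin X V" "V \<noteq> {}" "compact_within X V u"
      using core_compact_interpolate[OF assms(5)] u(1) by blast
    have "\<forall>x\<in>F. compact_within X V x"
      using u(2) compact_within_mono[OF V(3)] by blast
    thus ?thesis using V by blast
  qed
  have cf: "\<exists>y\<in>?Q. compact_within X y x \<and> compact_within X y U"
    if U: "U \<in> \<D>" and x: "x \<in> ?Q" for U x
  proof -
    \<comment> \<open>Density makes \<open>x \<inter> U\<close> non-empty, and a non-empty open set
      compact in it serves both requirements at once.\<close>
    have "openin X (x \<inter> U)" using x \<D>(1)[OF U] by auto
    moreover have "x \<inter> U \<noteq> {}"
      using \<D>(2)[OF U] x unfolding dense_in_def by (metis (lifting) Int_commute dense_intersects_open mem_Collect_eq)
    ultimately obtain V where V: "openin X V" "V \<noteq> {}" "compact_within X V (x \<inter> U)"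
      using core_compact_interpolate[OF assms(5)] by blast
    thus ?thesis
      using compact_within_mono[OF V(3), of V] by (intro bexI[of _ V]) auto
  qed
  obtain E where E: "E \<subseteq> ?Q" "E \<noteq> {}"
    "\<And>x y. x \<in> E \<Longrightarrow> y \<in> E \<Longrightarrow> \<exists>z\<in>E. compact_within X z x \<and> compact_within X z y"
    "\<And>U. U \<in> \<D> \<Longrightarrow> \<exists>y\<in>E. compact_within X y U"
    by (rule way_below_filter[where w = "compact_within X" and A = "\<lambda>U y. compact_within X y U",
          OF assms(1,2) ne _ _ \<R>(1,2)])
      (rule tr, assumption+, rule an, assumption+, rule sg, assumption+, rule cf, assumption+,
        rule that)
  define F where "F = {V. openin X V \<and> (\<exists>e\<in>E. e \<subseteq> V)}"
  have F_Int: "U \<inter> V \<in> F" if UV: "U \<in> F" "V \<in> F" for U V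
  proof -
    obtain e f where e: "e \<in> E" "e \<subseteq> U" "f \<in> E" "f \<subseteq> V"
      using UV unfolding F_def by blast
    obtain z where z: "z \<in> E" "compact_within X z e" "compact_within X z f"
      using E(3)[OF e(1,3)] by blast
    have "z \<subseteq> e" "z \<subseteq> f" using compact_within_subset z e E(1) by blast+
    thus ?thesis using UV e z(1) unfolding F_def by blast
  qed
  have F_up: "V \<in> F" if "U \<in> F" "U \<subseteq> V" "openin X V" for U V
    using that unfolding F_def by blast
  have "\<exists>M\<in>{U. openin X U} - F. \<forall>U\<in>{U. openin X U} - F. M \<subseteq> U \<longrightarrow> U = M"
  proof (rule subset_Zorn_nonempty)
    have "{} \<notin> F" using E(1) unfolding F_def by auto
    thus "{U. openin X U} - F \<noteq> {}" using openin_empty by blast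
    fix \<C> assume \<C>: "\<C> \<noteq> {}" "subset.chain ({U. openin X U} - F) \<C>"
    have \<C>o: "\<And>C. C \<in> \<C> \<Longrightarrow> openin X C" "\<And>C. C \<in> \<C> \<Longrightarrow> C \<notin> F"
      using \<C>(2) unfolding subset.chain_def by blast+
    have "\<Union>\<C> \<notin> F"
    proof
      assume "\<Union>\<C> \<in> F"
      then obtain e where e: "e \<in> E" "e \<subseteq> \<Union>\<C>" unfolding F_def by blast
      obtain z where z: "z \<in> E" "compact_within X z e" using E(3)[OF e(1,1)] by blast
      \<comment> \<open>Scott openness at work: finitely many members of the chain cover z, and the
        largest of them then contains z, so it would lie in F.\<close>
      obtain \<F> where \<F>: "\<F> \<subseteq> \<C>" "finite \<F>" "z \<subseteq> \<Union>\<F>"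
        using z(2) e(2) \<C>o(1) unfolding compact_within_def by meson
      have "\<F> \<noteq> {}" using \<F>(3) z(1) E(1) by auto
      moreover have "subset.chain ({U. openin X U} - F) \<F>"
        using \<C>(2) \<F>(1) unfolding subset_chain_def by (meson subset_iff)
      ultimately have "\<Union>\<F> \<in> \<F>"
        using \<F>(2) by (intro Union_in_chain)
      hence "\<Union>\<F> \<in> F"
        using z(1) \<F> \<C>o(1) unfolding F_def by blast
      thus False using \<open>\<Union>\<F> \<in> \<F>\<close> \<F>(1) \<C>o(2) by blast
    qed
    thus "\<Union>\<C> \<in> {U. openin X U} - F" using \<C>o(1) by auto
  qed
  then obtain M where M: "openin X M" "M \<notin> F"
    "\<And>U. openin X U \<Longrightarrow> U \<notin> F \<Longrightarrow> M \<subseteq> U \<Longrightarrow> U = M"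
    by auto
  have MF: "M \<union> U \<in> F" if "openin X U" "\<not> U \<subseteq> M" for U
    using M(3)[of "M \<union> U"] M(1) that by blast
  let ?C = "topspace X - M"
  have "irreducible_in X ?C"
    unfolding irreducible_in_def is_filterbase_def
  proof (intro conjI ballI)
    show "closedin X ?C" by (rule openin_closedin_eq[THEN iffD1, OF M(1), THEN conjunct2])
    obtain e where e: "e \<in> E" using E(2) by auto
    hence "openin X e" using E(1) by auto
    hence "topspace X \<in> F"
      using e openin_subset unfolding F_def by auto
    hence "M \<noteq> topspace X" using M(2) by auto
    hence "?C \<noteq> {}" using openin_subset[OF M(1)] by auto
    thus "{U. openin (subtopology X ?C) U \<and> U \<noteq> {}} \<noteq> {}"
      using openin_topspace[of "subtopology X ?C"] by (auto simp del: openin_topspace)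
    show "{} \<notin> {U. openin (subtopology X ?C) U \<and> U \<noteq> {}}" by simp
    fix A B assume "A \<in> {U. openin (subtopology X ?C) U \<and> U \<noteq> {}}"
      "B \<in> {U. openin (subtopology X ?C) U \<and> U \<noteq> {}}"
    then obtain U V where UV: "openin X U" "A = U \<inter> ?C" "openin X V" "B = V \<inter> ?C"
      "U \<inter> ?C \<noteq> {}" "V \<inter> ?C \<noteq> {}"
      by (auto simp: openin_subtopology)
    \<comment> \<open>Both factors properly extend M, so they are in F by maximality. If U and V met
      only inside M, their intersection would be M itself.\<close>
    have "(M \<union> U) \<inter> (M \<union> V) \<in> F"
      using UV by (intro F_Int MF) auto
    hence "M \<union> (U \<inter> V) \<in> F" by (simp add: Un_Int_distrib)
    hence "\<not> U \<inter> V \<subseteq> M" using M(2) by (metis Un_absorb2)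
    moreover have "U \<inter> V \<subseteq> topspace X" using UV(1) openin_subset by blast
    ultimately have "A \<inter> B \<noteq> {}" using UV by blast
    moreover have "openin (subtopology X ?C) (A \<inter> B)"
      unfolding UV by (auto simp: openin_subtopology intro!: exI[of _ "U \<inter> V"] UV)
    ultimately show "\<exists>C\<in>{U. openin (subtopology X ?C) U \<and> U \<noteq> {}}. C \<subseteq> A \<inter> B" by blast
  qed
  moreover have "?C \<inter> U \<noteq> {}" if U: "U \<in> \<D>" for U
  proof -
    obtain y where y: "y \<in> E" "compact_within X y U" using E(4)[OF U] by blast
    have "y \<subseteq> U" using compact_within_subset y \<D>(1)[OF U] by blast
    hence "U \<in> F" using y(1) \<D>(1)[OF U] unfolding F_def by blast
    hence "\<not> U \<subseteq> M" using F_up M(1,2) by blast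
    thus ?thesis using \<D>(1)[OF U] openin_subset by blast
  qed
  ultimately show thesis using that by blast
qed

section \<open>From separable, locally compact and sober spaces to the general case\<close>

text \<open>The open sets around one point of a dense set are centered, since finite intersections
  still contain that point.\<close>

lemma separable_imp_sigma_centered_space:
  assumes "separable_space X"
  shows "sigma_centered_space X"
proof -
  obtain S where S: "countable S" "S \<subseteq> topspace X" "X closure_of S = topspace X"
    using assms unfolding separable_space_def by blast
  let ?R = "\<lambda>s. {U. openin X U \<and> s \<in> U}"
  let ?Q = "{U. openin X U \<and> U \<noteq> {}}"
  let ?P = "\<lparr>carrier = ?Q, eq = (=), le = (\<lambda>U V. V \<subseteq> U)\<rparr>"
  have "upwards_centered_in ?P (?R s)" if s: "s \<in> S" for s
    unfolding upwards_centered_in_def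
  proof (intro conjI allI impI)
    show "?R s \<subseteq> carrier ?P" by auto
    fix F assume F: "finite F \<and> F \<subseteq> ?R s"
    \<comment> \<open>The factor \<open>topspace X\<close> is there for \<open>F = {}\<close>, where
      \<open>\<Inter>F\<close> is the whole type.\<close>
    have "openin X (topspace X \<inter> \<Inter>F)"
    proof (cases "F = {}")
      case False
      have "openin X (\<Inter>F)" using F by (intro openin_Inter[OF _ False]) auto
      thus ?thesis by (intro openin_Int openin_topspace)
    qed simp
    moreover have "s \<in> topspace X \<inter> \<Inter>F" using F s S(2) by auto
    ultimately show "\<exists>u\<in>carrier ?P. \<forall>x\<in>F. x \<sqsubseteq>\<^bsub>?P\<^esub> u"
      by (intro bexI[of _ "topspace X \<inter> \<Inter>F"]) auto
  qed
  moreover have "\<Union>(?R ` S) = ?Q"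
  proof (rule subset_antisym)
    show "?Q \<subseteq> \<Union>(?R ` S)"
    proof
      fix U assume "U \<in> ?Q"
      moreover from this have "S \<inter> U \<noteq> {}" using S(3) dense_intersects_open[of X S] by simp
      ultimately show "U \<in> \<Union>(?R ` S)" by blast
    qed
  qed auto
  ultimately show ?thesis
    unfolding sigma_centered_space_def upwards_sigma_centered_def
    using S(1) by (intro exI[of _ "?R ` S"]) auto
qed

text \<open>An open set squeezed into a compact \<open>K \<subseteq> W\<close> inherits finite
  subcovers from K, so it is compact in W.\<close>

lemma locally_compact_base_imp_core_compact_space:
  assumes "locally_compact_base_space X"
  shows "core_compact_space X"
  unfolding core_compact_space_def
proof (intro allI impI subset_antisym subsetI)
  fix W x assume W: "openin X W" and "x \<in> W"
  then obtain U K where U: "openin X U" "compactin X K" "x \<in> U" "U \<subseteq> K" "K \<subseteq> W"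
    using assms unfolding locally_compact_base_space_def neighbourhood_base_of by meson
  have "compact_within X U W"
    unfolding compact_within_def
  proof (intro allI impI)
    fix \<C> assume \<C>: "(\<forall>C\<in>\<C>. openin X C) \<and> W \<subseteq> \<Union>\<C>"
    hence "\<exists>\<F>. finite \<F> \<and> \<F> \<subseteq> \<C> \<and> K \<subseteq> \<Union>\<F>"
      using U(2,5) unfolding compactin_def by (meson order_trans)
    thus "\<exists>\<F>\<subseteq>\<C>. finite \<F> \<and> U \<subseteq> \<Union>\<F>" using U(4) by blast
  qed
  thus "x \<in> \<Union>{V. openin X V \<and> compact_within X V W}" using U by blast
next
  fix W x assume "openin X W" "x \<in> \<Union>{V. openin X V \<and> compact_within X V W}"
  thus "x \<in> W" using compact_within_subset by blast
qed

text \<open>The generic point of C lies in every open set that meets C.\<close>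

lemma irreducible_meets_imp_Inter_nonempty:
  assumes "sober_space X" "irreducible_in X C"
    and "\<And>U. U \<in> \<D> \<Longrightarrow> openin X U \<and> C \<inter> U \<noteq> {}"
  shows "topspace X \<inter> \<Inter>\<D> \<noteq> {}"
proof -
  obtain x where x: "x \<in> topspace X" "C = X closure_of {x}"
    using assms(1,2) unfolding sober_space_def by blast
  have "x \<in> U" if U: "U \<in> \<D>" for U
  proof -
    have "U \<inter> X closure_of {x} \<noteq> {}" using assms(3)[OF U] x(2) by blast
    hence "U \<inter> {x} \<noteq> {}" using openin_Int_closure_of_eq_empty assms(3)[OF U] by blast
    thus ?thesis by blast
  qed
  thus ?thesis using x(1) by blast
qed

section \<open>Continuous lattices\<close>

text \<open>Everything strictly above the maximal p lies in the filter F. As F is closed under meets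
  and omits p, the element p is not a meet of two elements strictly above it.\<close>

lemma continuous_lattice_baire:
  fixes L :: "'l gorder"
  assumes "large_type TYPE('p)" "|D| <o cardinal_p TYPE('p)"
    and "complete_lattice L" "\<bottom>\<^bsub>L\<^esub> \<noteq> \<top>\<^bsub>L\<^esub>" "upwards_continuous L" "downwards_sigma_centered L"
    and nzd: "\<And>d. d \<in> D \<Longrightarrow> non_zero_divisor L d"
  obtains p where "irreducible_element L p" "\<And>d. d \<in> D \<Longrightarrow> \<not> d \<sqsubseteq>\<^bsub>L\<^esub> p"
proof -
  interpret complete_lattice L by fact
  let ?Q = "carrier L - {\<bottom>\<^bsub>L\<^esub>}"
  let ?w = "way_below_in L"
  have wb_le: "?w x z" if "?w x y" "y \<sqsubseteq>\<^bsub>L\<^esub> z" "y \<in> carrier L" "z \<in> carrier L" for x y z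
    unfolding way_below_in_def
  proof (intro allI impI)
    fix E s assume E: "directed_in L E \<and> least L s (Upper L E) \<and> z \<sqsubseteq>\<^bsub>L\<^esub> s"
    hence "s \<in> carrier L" using least_closed by blast
    hence "y \<sqsubseteq>\<^bsub>L\<^esub> s" using le_trans[of y z s] E that by simp
    thus "\<exists>e\<in>E. x \<sqsubseteq>\<^bsub>L\<^esub> e" using that(1) E unfolding way_below_in_def by meson
  qed
  have wb_imp_le: "x \<sqsubseteq>\<^bsub>L\<^esub> y" if "?w x y" "y \<in> carrier L" for x y
  proof -
    \<comment> \<open>Testing way-below on the constant directed set.\<close>
    have "directed_in L {y}" "least L y (Upper L {y})"
      using that(2) by (auto simp: directed_in_def least_def Upper_def)
    thus ?thesis using that unfolding way_below_in_def by (metis le_refl singletonD)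
  qed
  \<comment> \<open>If only bottom were way below x, then bottom would bound all elements way below
    x, and continuity would force x to be bottom.\<close>
  have interp: "\<exists>y\<in>?Q. ?w y x" if x: "x \<in> ?Q" for x
  proof (rule ccontr)
    assume no: "\<not> (\<exists>y\<in>?Q. ?w y x)"
    have "least L x (Upper L {y \<in> carrier L. ?w y x})"
      using assms(5) x unfolding upwards_continuous_def by blast
    moreover have "\<bottom>\<^bsub>L\<^esub> \<in> Upper L {y \<in> carrier L. ?w y x}"
      using no by (auto simp: Upper_def)
    ultimately have "x \<sqsubseteq>\<^bsub>L\<^esub> \<bottom>\<^bsub>L\<^esub>" by (simp add: least_def)
    hence "x = \<bottom>\<^bsub>L\<^esub>" using x le_antisym[of x "\<bottom>\<^bsub>L\<^esub>"] by simp
    thus False using x by simp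
  qed
  obtain \<R> where \<R>: "countable \<R>" "\<Union>\<R> = ?Q"
    "\<And>R. R \<in> \<R> \<Longrightarrow> upwards_centered_in (inv_gorder (L\<lparr>carrier := ?Q\<rparr>)) R"
    using assms(6) unfolding downwards_sigma_centered_def
    by (elim upwards_sigma_centeredE) (rule that, simp_all)
  have "\<top>\<^bsub>L\<^esub> \<in> ?Q" using assms(4) by simp
  hence ne: "?Q \<noteq> {}" by blast
  have tr: "?w x z" if "x \<in> ?Q" "y \<in> ?Q" "z \<in> ?Q" "?w x y" "?w y z" for x y z
    using wb_le[OF that(4) wb_imp_le[OF that(5)]] that by simp
  have an: "x = y" if "x \<in> ?Q" "y \<in> ?Q" "?w x y" "?w y x" for x y
    using le_antisym[OF wb_imp_le[OF that(3)] wb_imp_le[OF that(4)]] that by simp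
  have sg: "\<exists>u\<in>?Q. \<forall>x\<in>F. ?w u x" if R: "R \<in> \<R>" and F: "finite F" "F \<subseteq> R" for R F
  proof -
    have "\<exists>u\<in>?Q. \<forall>x\<in>F. u \<sqsubseteq>\<^bsub>L\<^esub> x"
      using \<R>(3)[OF R] F unfolding upwards_centered_in_def by simp
    then obtain u where u: "u \<in> ?Q" "\<forall>x\<in>F. u \<sqsubseteq>\<^bsub>L\<^esub> x" by meson
    obtain v where v: "v \<in> ?Q" "?w v u" using interp[OF u(1)] by blast
    have "?w v x" if x: "x \<in> F" for x
    proof -
      have "x \<in> carrier L" using x F(2) R \<R>(2) by blast
      thus ?thesis using wb_le[OF v(2), of x] u x by simp
    qed
    thus ?thesis using v(1) by blast
  qed
  have cf: "\<exists>y\<in>?Q. ?w y x \<and> ?w y d" if d: "d \<in> D" and x: "x \<in> ?Q" for d x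
  proof -
    have dc: "d \<in> carrier L" and "d \<sqinter>\<^bsub>L\<^esub> x \<noteq> \<bottom>\<^bsub>L\<^esub>"
      using nzd[OF d] x unfolding non_zero_divisor_def by auto
    moreover have "d \<sqinter>\<^bsub>L\<^esub> x \<in> carrier L" using dc x by simp
    ultimately obtain y where y: "y \<in> ?Q" "?w y (d \<sqinter>\<^bsub>L\<^esub> x)" using interp[of "d \<sqinter>\<^bsub>L\<^esub> x"] by blast
    have "?w y x" "?w y d"
      using wb_le[OF y(2), of x] wb_le[OF y(2), of d] meet_left[of d x] meet_right[of d x] dc x
      by simp_all
    thus ?thesis using y(1) by blast
  qed
  obtain E where E: "E \<subseteq> ?Q" "E \<noteq> {}"
    "\<And>x y. x \<in> E \<Longrightarrow> y \<in> E \<Longrightarrow> \<exists>z\<in>E. ?w z x \<and> ?w z y"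
    "\<And>d. d \<in> D \<Longrightarrow> \<exists>y\<in>E. ?w y d"
    by (rule way_below_filter[where w = ?w and A = "\<lambda>d y. ?w y d",
          OF assms(1,2) ne _ _ \<R>(1,2)])
      (rule tr, assumption+, rule an, assumption+, rule sg, assumption+, rule cf, assumption+,
        rule that)
  have Ec: "E \<subseteq> carrier L" using E(1) by blast
  define F where "F = {x \<in> carrier L. \<exists>e\<in>E. e \<sqsubseteq>\<^bsub>L\<^esub> x}"
  have F_up: "y \<in> F" if xy: "x \<in> F" "x \<sqsubseteq>\<^bsub>L\<^esub> y" "y \<in> carrier L" for x y
  proof -
    obtain e where "e \<in> E" "e \<sqsubseteq>\<^bsub>L\<^esub> x" using xy(1) by (auto simp: F_def)
    moreover from this have "e \<sqsubseteq>\<^bsub>L\<^esub> y"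
      using le_trans[of e x y] xy Ec by (auto simp: F_def)
    ultimately show ?thesis using xy(3) by (auto simp: F_def)
  qed
  let ?A = "carrier L - F"
  have "\<exists>m\<in>?A. \<forall>a\<in>?A. m \<sqsubseteq>\<^bsub>L\<^esub> a \<longrightarrow> a = m"
  proof (rule predicate_Zorn)
    show "partial_order_on ?A (relation_of (\<sqsubseteq>\<^bsub>L\<^esub>) ?A)"
      by (rule partial_order_on_relation_ofI) (auto intro: le_trans le_antisym)
    fix C assume "C \<in> Chains (relation_of (\<sqsubseteq>\<^bsub>L\<^esub>) ?A)"
    hence C: "C \<subseteq> ?A" "\<And>a b. a \<in> C \<Longrightarrow> b \<in> C \<Longrightarrow> a \<sqsubseteq>\<^bsub>L\<^esub> b \<or> b \<sqsubseteq>\<^bsub>L\<^esub> a"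
      unfolding Chains_def relation_of_def by auto
    show "\<exists>u\<in>?A. \<forall>a\<in>C. a \<sqsubseteq>\<^bsub>L\<^esub> u"
    proof (cases "C = {}")
      \<comment> \<open>The empty chain also needs a bound outside F; bottom qualifies because E
        consists of non-zero elements.\<close>
      case True
      have "\<bottom>\<^bsub>L\<^esub> \<notin> F"
      proof
        assume "\<bottom>\<^bsub>L\<^esub> \<in> F"
        then obtain e where e: "e \<in> E" "e \<sqsubseteq>\<^bsub>L\<^esub> \<bottom>\<^bsub>L\<^esub>" by (auto simp: F_def)
        hence "e = \<bottom>\<^bsub>L\<^esub>" using le_antisym[of e "\<bottom>\<^bsub>L\<^esub>"] Ec by auto
        thus False using e(1) E(1) by blast
      qed
      thus ?thesis using True by auto
    next
      case False
      have Cc: "C \<subseteq> carrier L" using C(1) by blast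
      obtain s where s: "least L s (Upper L C)" using sup_exists[OF Cc] by blast
      have sc: "s \<in> carrier L" using s by simp
      have dir: "directed_in L C"
        unfolding directed_in_def
      proof (intro conjI ballI Cc False)
        fix x y assume "x \<in> C" "y \<in> C"
        thus "\<exists>z\<in>C. x \<sqsubseteq>\<^bsub>L\<^esub> z \<and> y \<sqsubseteq>\<^bsub>L\<^esub> z"
          using C(2)[of x y] Cc le_refl by (meson subsetD)
      qed
      have "s \<notin> F"
      proof
        assume "s \<in> F"
        then obtain e where e: "e \<in> E" "e \<sqsubseteq>\<^bsub>L\<^esub> s" by (auto simp: F_def)
        obtain z where z: "z \<in> E" "?w z e" using E(3)[OF e(1) e(1)] by blast
        \<comment> \<open>A non-empty chain is directed, so z way below
          \<open>e \<sqsubseteq> s\<close> puts a member of the chain above z.\<close>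
        obtain c where c: "c \<in> C" "z \<sqsubseteq>\<^bsub>L\<^esub> c"
          using z(2) dir s e(2) unfolding way_below_in_def by meson
        hence "c \<in> F" using z(1) Cc by (auto simp: F_def)
        thus False using c(1) C(1) by blast
      qed
      moreover have "\<forall>a\<in>C. a \<sqsubseteq>\<^bsub>L\<^esub> s"
        using s Cc by (auto simp: least_def Upper_def)
      ultimately show ?thesis using sc by blast
    qed
  qed
  then obtain p where p: "p \<in> carrier L" "p \<notin> F"
    "\<And>a. a \<in> carrier L \<Longrightarrow> a \<notin> F \<Longrightarrow> p \<sqsubseteq>\<^bsub>L\<^esub> a \<Longrightarrow> a = p"
    by blast
  have "irreducible_element L p"
    unfolding irreducible_element_def
  proof (intro conjI ballI impI p(1))
    fix a b assume ab: "a \<in> carrier L" "b \<in> carrier L" "p = a \<sqinter>\<^bsub>L\<^esub> b"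
    show "p = a \<or> p = b"
    proof (rule ccontr)
      assume "\<not> (p = a \<or> p = b)"
      moreover have "p \<sqsubseteq>\<^bsub>L\<^esub> a" "p \<sqsubseteq>\<^bsub>L\<^esub> b"
        using ab meet_left[of a b] meet_right[of a b] by simp_all
      ultimately have "a \<in> F" "b \<in> F" using p(3)[of a] p(3)[of b] ab by blast+
      then obtain e f where e: "e \<in> E" "e \<sqsubseteq>\<^bsub>L\<^esub> a" "f \<in> E" "f \<sqsubseteq>\<^bsub>L\<^esub> b" by (auto simp: F_def)
      obtain z where z: "z \<in> E" "?w z e" "?w z f" using E(3)[OF e(1,3)] by blast
      have c: "z \<in> carrier L" "e \<in> carrier L" "f \<in> carrier L" using z(1) e(1,3) Ec by blast+
      have "z \<sqsubseteq>\<^bsub>L\<^esub> a" "z \<sqsubseteq>\<^bsub>L\<^esub> b"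
        using le_trans[OF wb_imp_le[OF z(2) c(2)] e(2)] le_trans[OF wb_imp_le[OF z(3) c(3)] e(4)] c ab
        by simp_all
      hence "z \<sqsubseteq>\<^bsub>L\<^esub> p" using meet_le[of z a b] c ab by simp
      hence "p \<in> F" using z(1) p(1) by (auto simp: F_def)
      thus False using p(2) by simp
    qed
  qed
  moreover have "\<not> d \<sqsubseteq>\<^bsub>L\<^esub> p" if d: "d \<in> D" for d
  proof
    assume le: "d \<sqsubseteq>\<^bsub>L\<^esub> p"
    have dc: "d \<in> carrier L" using nzd[OF d] by (simp add: non_zero_divisor_def)
    obtain y where y: "y \<in> E" "?w y d" using E(4)[OF d] by blast
    hence "d \<in> F" using wb_imp_le[OF y(2) dc] dc by (auto simp: F_def)
    thus False using F_up[OF _ le p(1)] p(2) by simp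
  qed
  ultimately show thesis using that by blast
qed

subsection \<open>The space of centered sets\<close>

text \<open>A point x codes the set \<open>c x\<close>. This is the topology that \<open>c\<close>
  pulls back from the power set viewed as a product of Sierpinski spaces. Codes replace sets so that
  the space can live on a prescribed type.\<close>

definition finite_part_topology :: "'b set \<Rightarrow> ('b \<Rightarrow> 'q set) \<Rightarrow> 'b topology" where
  "finite_part_topology S c = topology (\<lambda>U. U \<subseteq> S \<and>
     (\<forall>x\<in>U. \<exists>F. finite F \<and> F \<subseteq> c x \<and> {y \<in> S. F \<subseteq> c y} \<subseteq> U))"

lemma openin_finite_part_topology:
  "openin (finite_part_topology S c) U \<longleftrightarrow>
     U \<subseteq> S \<and> (\<forall>x\<in>U. \<exists>F. finite F \<and> F \<subseteq> c x \<and> {y \<in> S. F \<subseteq> c y} \<subseteq> U)"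
proof -
  let ?T = "\<lambda>U. U \<subseteq> S \<and> (\<forall>x\<in>U. \<exists>F. finite F \<and> F \<subseteq> c x \<and> {y \<in> S. F \<subseteq> c y} \<subseteq> U)"
  have "istopology ?T"
    unfolding istopology_def
  proof (intro conjI allI impI ballI)
    fix U V x assume UV: "?T U" "?T V" "x \<in> U \<inter> V"
    then obtain F G where "finite F" "F \<subseteq> c x" "{y \<in> S. F \<subseteq> c y} \<subseteq> U"
      "finite G" "G \<subseteq> c x" "{y \<in> S. G \<subseteq> c y} \<subseteq> V" by (meson IntD1 IntD2)
    thus "\<exists>F. finite F \<and> F \<subseteq> c x \<and> {y \<in> S. F \<subseteq> c y} \<subseteq> U \<inter> V"
      by (intro exI[of _ "F \<union> G"]) auto
  next
    fix \<K> x assume \<K>: "\<forall>K\<in>\<K>. ?T K" "x \<in> \<Union>\<K>"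
    then obtain K F where "K \<in> \<K>" "finite F" "F \<subseteq> c x" "{y \<in> S. F \<subseteq> c y} \<subseteq> K"
      by (meson UnionE)
    thus "\<exists>F. finite F \<and> F \<subseteq> c x \<and> {y \<in> S. F \<subseteq> c y} \<subseteq> \<Union>\<K>"
      by (intro exI[of _ F]) auto
  qed auto
  thus ?thesis
    unfolding finite_part_topology_def by (simp add: topology_inverse')
qed

lemma openin_finite_part_basic:
  "finite F \<Longrightarrow> openin (finite_part_topology S c) {y \<in> S. F \<subseteq> c y}"
  unfolding openin_finite_part_topology by auto

lemma finite_part_nbhdE:
  assumes "openin (finite_part_topology S c) T" "x \<in> T"
  obtains F where "finite F" "F \<subseteq> c x" "{y \<in> S. F \<subseteq> c y} \<subseteq> T" "x \<in> S"
  using assms unfolding openin_finite_part_topology by (meson subsetD)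

lemma topspace_finite_part_topology [simp]: "topspace (finite_part_topology S c) = S"
proof -
  have "openin (finite_part_topology S c) S"
    using openin_finite_part_basic[of "{}" S c] by simp
  thus ?thesis
    using openin_subset openin_topspace openin_finite_part_topology by (metis subset_antisym)
qed

section \<open>Local compactness and sobriety from finite character\<close>

text \<open>The hypothesis says that the coded sets form a family of finite character. Hence a
  non-empty basic set given by F has a least point, coding F itself, and any open set containing
  that point contains the whole basic set. One member of a cover is enough.\<close>

lemma locally_compact_finite_part_topology:
  assumes fc: "\<And>G. (\<And>F. finite F \<Longrightarrow> F \<subseteq> G \<Longrightarrow> \<exists>x\<in>S. F \<subseteq> c x) \<Longrightarrow> \<exists>g\<in>S. c g = G"
  shows "locally_compact_base_space (finite_part_topology S c)"
  unfolding locally_compact_base_space_def neighbourhood_base_of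
proof (intro allI impI)
  let ?X = "finite_part_topology S c"
  fix W x assume W: "openin ?X W \<and> x \<in> W"
  then obtain F where F: "finite F" "F \<subseteq> c x" "{y \<in> S. F \<subseteq> c y} \<subseteq> W" and "x \<in> S"
    by (elim conjE finite_part_nbhdE)
  let ?U = "{y \<in> S. F \<subseteq> c y}"
  obtain g where g: "g \<in> S" "c g = F"
    using fc[of F] F(2) \<open>x \<in> S\<close> by (meson order_trans)
  have "compactin ?X ?U"
    unfolding compactin_def
  proof (intro conjI allI impI)
    fix \<U> assume \<U>: "Ball \<U> (openin ?X) \<and> ?U \<subseteq> \<Union>\<U>"
    then obtain T where T: "T \<in> \<U>" "g \<in> T" using g by auto
    have "openin ?X T" using T(1) \<U> by auto
    then obtain F' where "F' \<subseteq> F" "{y \<in> S. F' \<subseteq> c y} \<subseteq> T"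
      using T(2) g(2) by (metis finite_part_nbhdE)
    hence "?U \<subseteq> \<Union>{T}" by auto
    thus "\<exists>\<F>. finite \<F> \<and> \<F> \<subseteq> \<U> \<and> ?U \<subseteq> \<Union>\<F>"
      using T(1) by (intro exI[of _ "{T}"]) auto
  qed auto
  thus "\<exists>U V. openin ?X U \<and> compactin ?X V \<and> x \<in> U \<and> U \<subseteq> V \<and> V \<subseteq> W"
    using F \<open>x \<in> S\<close> openin_finite_part_basic[OF F(1)] by (intro exI[of _ ?U]) auto
qed

text \<open>The generic point of an irreducible C codes the union G of all sets coded in C.
  Irreducibility puts every finite part of G inside a single member of C, finite character then
  makes G a coded set, and closedness puts its code into C.\<close>

lemma sober_finite_part_topology:
  assumes inj: "inj_on c S"
    and fc: "\<And>G. (\<And>F. finite F \<Longrightarrow> F \<subseteq> G \<Longrightarrow> \<exists>x\<in>S. F \<subseteq> c x) \<Longrightarrow> \<exists>g\<in>S. c g = G"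
  shows "sober_space (finite_part_topology S c)"
  unfolding sober_space_def
proof (intro conjI allI impI)
  let ?X = "finite_part_topology S c"
  have sep: "\<exists>U. openin ?X U \<and> (x \<notin> U) = (y \<in> U)"
    if "x \<in> S" "y \<in> S" "a \<in> c x" "a \<notin> c y" for x y a
    using that openin_finite_part_basic[of "{a}" S c]
    by (intro exI[of _ "{y \<in> S. {a} \<subseteq> c y}"]) auto
  show "t0_space ?X"
    unfolding t0_space_def topspace_finite_part_topology
  proof (intro ballI impI)
    fix x y assume xy: "x \<in> S" "y \<in> S" "x \<noteq> y"
    hence "c x \<noteq> c y" using inj by (simp add: inj_on_eq_iff)
    then obtain a where "a \<in> c x \<and> a \<notin> c y \<or> a \<in> c y \<and> a \<notin> c x" by blast
    thus "\<exists>U. openin ?X U \<and> (x \<notin> U) = (y \<in> U)"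
      using sep[of x y a] sep[of y x a] xy(1,2) by blast
  qed
next
  let ?X = "finite_part_topology S c"
  fix C assume C: "irreducible_in ?X C"
  have clC: "closedin ?X C" and fb: "is_filterbase {U. openin (subtopology ?X C) U \<and> U \<noteq> {}}"
    using C by (auto simp: irreducible_in_def)
  have CS: "C \<subseteq> S" using closedin_subset[OF clC] by simp
  have op: "openin ?X (S - C)" using clC by (simp add: closedin_def)
  define G where "G = \<Union>(c ` C)"
  \<comment> \<open>Induction on F: the basic sets for F and for the new element both meet C, so the
    filterbase property makes them meet inside C.\<close>
  have G: "\<exists>x\<in>C. F \<subseteq> c x" if "finite F" "F \<subseteq> G" for F
    using that
  proof (induction F)
    case empty
    have "{U. openin (subtopology ?X C) U \<and> U \<noteq> {}} \<noteq> {}"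
      using fb by (simp add: is_filterbase_def)
    then obtain U where U: "openin (subtopology ?X C) U" "U \<noteq> {}" by blast
    then obtain x where "x \<in> U" by blast
    hence "x \<in> C" using openin_subset[OF U(1)] by auto
    thus ?case by auto
  next
    case (insert a F)
    let ?B = "\<lambda>F. {y \<in> S. F \<subseteq> c y} \<inter> C"
    obtain x y where xy: "x \<in> C" "F \<subseteq> c x" "y \<in> C" "a \<in> c y"
      using insert unfolding G_def by auto
    have op: "openin (subtopology ?X C) (?B F)" "openin (subtopology ?X C) (?B {a})"
      using openin_finite_part_basic[OF insert(1), of S c]
        openin_finite_part_basic[of "{a}" S c]
      by (meson finite.emptyI finite.insertI openin_subtopology)+
    have "x \<in> ?B F" "y \<in> ?B {a}" using xy CS by auto
    hence "?B F \<noteq> {}" "?B {a} \<noteq> {}" by blast+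
    hence "\<exists>V. (openin (subtopology ?X C) V \<and> V \<noteq> {}) \<and> V \<subseteq> ?B F \<inter> ?B {a}"
      using fb op unfolding is_filterbase_def by (metis (mono_tags, lifting) mem_Collect_eq)
    then obtain z where "z \<in> ?B F \<inter> ?B {a}" by blast
    thus ?case by auto
  qed
  have "\<exists>g\<in>S. c g = G"
    by (rule fc) (use G CS in blast)
  then obtain g where g: "g \<in> S" "c g = G" by blast
  have "g \<in> C"
  proof (rule ccontr)
    assume "g \<notin> C"
    hence "g \<in> S - C" using g(1) by blast
    then obtain F where F: "finite F" "F \<subseteq> G" "{y \<in> S. F \<subseteq> c y} \<subseteq> S - C"
      using finite_part_nbhdE[OF op] g(2) by metis
    obtain x where "x \<in> C" "F \<subseteq> c x" using G[OF F(1,2)] by blast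
    thus False using F(3) CS by blast
  qed
  have "C = ?X closure_of {g}"
  proof (rule subset_antisym)
    show "?X closure_of {g} \<subseteq> C"
      using closure_of_minimal[OF _ clC] \<open>g \<in> C\<close> by simp
    show "C \<subseteq> ?X closure_of {g}"
    proof
      fix x assume x: "x \<in> C"
      have "g \<in> T" if T: "openin ?X T" "x \<in> T" for T
      proof -
        obtain F where "F \<subseteq> c x" "{y \<in> S. F \<subseteq> c y} \<subseteq> T"
          by (rule finite_part_nbhdE[OF T])
        moreover have "c x \<subseteq> G" using x by (auto simp: G_def)
        ultimately show ?thesis using g by auto
      qed
      thus "x \<in> ?X closure_of {g}" using x CS by (auto simp: in_closure_of)
    qed
  qed
  thus "\<exists>x\<in>topspace ?X. C = ?X closure_of {x}" using g(1) by auto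
qed

section \<open>The separable counterexample\<close>

lemma dense_in_iff:
  "dense_in X U \<longleftrightarrow> U \<subseteq> topspace X \<and> (\<forall>T. openin X T \<and> T \<noteq> {} \<longrightarrow> U \<inter> T \<noteq> {})"
  by (auto simp: dense_in_def dense_intersects_open)

text \<open>
  The points are the upwards centered sets; a centered set meeting the cofinal sets \<open>B a b\<close> below
  is directed, because its members are pairwise compatible.
\<close>

lemma separable_counterexample:
  fixes P :: "'q gorder" and J :: "'j set" and h :: "'q set \<Rightarrow> 'b"
  assumes unmet: "unmet_family P J D" and "|carrier P| \<le>o |J|" "inj h"
  obtains X :: "'b topology" and \<D> where "topspace X \<noteq> {}" "separable_space X"
    "locally_compact_base_space X" "sober_space X" "|\<D>| \<le>o |J|"
    "\<And>U. U \<in> \<D> \<Longrightarrow> openin X U \<and> dense_in X U" "topspace X \<inter> \<Inter>\<D> = {}"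
proof -
  interpret partial_order P by (rule unmet_familyD(1)[OF unmet])
  have infJ: "infinite J" by (rule unmet_family_infinite[OF unmet])
  define c where "c = inv h"
  have ch [simp]: "c (h A) = A" for A by (simp add: c_def assms(3))
  define S where "S = h ` {A. upwards_centered_in P A}"
  have S: "x \<in> S \<Longrightarrow> upwards_centered_in P (c x)" for x by (auto simp: S_def)
  have S': "upwards_centered_in P A \<Longrightarrow> h A \<in> S" for A by (auto simp: S_def)
  let ?X = "finite_part_topology S c"
  have inj: "inj_on c S" by (auto simp: S_def inj_on_def)
  have cent: "upwards_centered_in P F" if "F \<subseteq> carrier P" "u \<in> carrier P" "\<forall>x\<in>F. x \<sqsubseteq>\<^bsub>P\<^esub> u" for F u
    unfolding upwards_centered_in_def
    using that by (intro conjI allI impI bexI[of _ u]) auto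
  \<comment> \<open>Being upwards centered is a property of finite character.\<close>
  have fc: "\<exists>g\<in>S. c g = G" if G: "\<And>F. finite F \<Longrightarrow> F \<subseteq> G \<Longrightarrow> \<exists>x\<in>S. F \<subseteq> c x" for G
  proof -
    have "upwards_centered_in P G"
      unfolding upwards_centered_in_def
    proof (intro conjI allI impI subsetI)
      fix a assume "a \<in> G"
      then obtain x where "x \<in> S" "a \<in> c x" using G[of "{a}"] by auto
      thus "a \<in> carrier P" using S[of x] by (auto simp: upwards_centered_in_def)
    next
      fix F assume F: "finite F \<and> F \<subseteq> G"
      then obtain x where "x \<in> S" "F \<subseteq> c x" using G[of F] by auto
      thus "\<exists>u\<in>carrier P. \<forall>x\<in>F. x \<sqsubseteq>\<^bsub>P\<^esub> u"
        using S[of x] F by (simp add: upwards_centered_in_def)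
    qed
    thus ?thesis using S' by (intro bexI[of _ "h G"]) simp_all
  qed
  obtain p0 where p0: "p0 \<in> carrier P" using unmet_familyD(2)[OF unmet] by blast
  have "h {} \<in> S" by (rule S', rule cent[OF _ p0]) auto
  hence "topspace ?X \<noteq> {}" by auto
  moreover have "separable_space ?X"
  proof -
    obtain \<R> where \<R>: "countable \<R>" "\<And>R. R \<in> \<R> \<Longrightarrow> upwards_centered_in P R" "\<Union>\<R> = carrier P"
      by (rule upwards_sigma_centeredE[OF unmet_familyD(3)[OF unmet]]) (rule that)
    \<comment> \<open>The centered pieces are closed downwards to obtain dense points: a finite F
      bounded by some \<open>u \<in> R\<close> is then contained in \<open>dn R\<close>, and so the
      code of \<open>dn R\<close> lies in the basic set of F.\<close>
    define dn where "dn R = {x \<in> carrier P. \<exists>y\<in>R. x \<sqsubseteq>\<^bsub>P\<^esub> y}" for R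
    have dnc: "upwards_centered_in P (dn R)" if R: "R \<in> \<R>" for R
      unfolding upwards_centered_in_def
    proof (intro conjI allI impI)
      show "dn R \<subseteq> carrier P" by (auto simp: dn_def)
      have Rc: "R \<subseteq> carrier P" using R \<R>(3) by blast
      fix F assume F: "finite F \<and> F \<subseteq> dn R"
      hence "\<forall>x\<in>F. \<exists>y. y \<in> R \<and> x \<sqsubseteq>\<^bsub>P\<^esub> y" by (auto simp: dn_def)
      then obtain y where y: "\<forall>x\<in>F. y x \<in> R \<and> x \<sqsubseteq>\<^bsub>P\<^esub> y x" by metis
      have "finite (y ` F)" "y ` F \<subseteq> R" using F y by auto
      then obtain u where u: "u \<in> carrier P" "\<forall>z\<in>y ` F. z \<sqsubseteq>\<^bsub>P\<^esub> u"
        using \<R>(2)[OF R] unfolding upwards_centered_in_def by meson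
      have "x \<sqsubseteq>\<^bsub>P\<^esub> u" if x: "x \<in> F" for x
      proof (rule le_trans[of x "y x" u])
        show "x \<in> carrier P" using F x by (auto simp: dn_def)
        show "y x \<in> carrier P" using y Rc x by auto
      qed (use y u x in auto)
      thus "\<exists>u\<in>carrier P. \<forall>x\<in>F. x \<sqsubseteq>\<^bsub>P\<^esub> u" using u(1) by blast
    qed
    let ?K = "(\<lambda>R. h (dn R)) ` \<R>"
    have KS: "?K \<subseteq> S" using dnc S' by blast
    have "?K \<inter> T \<noteq> {}" if T: "openin ?X T" "T \<noteq> {}" for T
    proof -
      obtain x where "x \<in> T" using T(2) by blast
      then obtain F where F: "finite F" "F \<subseteq> c x" "{y \<in> S. F \<subseteq> c y} \<subseteq> T" and "x \<in> S"
        using finite_part_nbhdE[OF T(1)] by metis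
      obtain u where u: "u \<in> carrier P" "\<forall>x\<in>F. x \<sqsubseteq>\<^bsub>P\<^esub> u"
        using S[OF \<open>x \<in> S\<close>] F(1,2) unfolding upwards_centered_in_def by meson
      obtain R where R: "R \<in> \<R>" "u \<in> R" using u(1) \<R>(3) by blast
      have "F \<subseteq> carrier P" using S[OF \<open>x \<in> S\<close>] F(2) by (auto simp: upwards_centered_in_def)
      hence "F \<subseteq> dn R" using u(2) R(2) by (auto simp: dn_def)
      hence "h (dn R) \<in> T" using subsetD[OF F(3), of "h (dn R)"] S'[OF dnc[OF R(1)]] by simp
      thus ?thesis using R(1) by blast
    qed
    hence "?X closure_of ?K = topspace ?X" unfolding dense_intersects_open by blast
    thus ?thesis
      unfolding separable_space_def using KS \<R>(1) by (intro exI[of _ ?K]) simp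
  qed
  moreover have "locally_compact_base_space ?X"
    by (rule locally_compact_finite_part_topology[OF fc])
  moreover have "sober_space ?X"
    by (rule sober_finite_part_topology[OF inj fc])
  \<comment> \<open>Either z bounds both a and b, or z is incompatible with one of them. The second
    alternative makes the set cofinal even where no common bound is reachable, and two members of
    one centered set are never incompatible.\<close>
  moreover define B where "B a b = {z \<in> carrier P. a \<sqsubseteq>\<^bsub>P\<^esub> z \<and> b \<sqsubseteq>\<^bsub>P\<^esub> z \<or>
      \<not> (\<exists>u\<in>carrier P. a \<sqsubseteq>\<^bsub>P\<^esub> u \<and> z \<sqsubseteq>\<^bsub>P\<^esub> u) \<or> \<not> (\<exists>u\<in>carrier P. b \<sqsubseteq>\<^bsub>P\<^esub> u \<and> z \<sqsubseteq>\<^bsub>P\<^esub> u)}" for a b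
  have B_cof: "cofinal_in P (B a b)" if a: "a \<in> carrier P" and b: "b \<in> carrier P" for a b
    unfolding cofinal_in_def
  proof (intro conjI ballI)
    show "B a b \<subseteq> carrier P" by (auto simp: B_def)
    fix u assume u: "u \<in> carrier P"
    show "\<exists>d\<in>B a b. u \<sqsubseteq>\<^bsub>P\<^esub> d"
    proof (cases "\<exists>v\<in>carrier P. a \<sqsubseteq>\<^bsub>P\<^esub> v \<and> u \<sqsubseteq>\<^bsub>P\<^esub> v")
      case False
      hence "u \<in> B a b" using u by (simp add: B_def)
      thus ?thesis using u by auto
    next
      case True
      then obtain v where v: "v \<in> carrier P" "a \<sqsubseteq>\<^bsub>P\<^esub> v" "u \<sqsubseteq>\<^bsub>P\<^esub> v" by blast
      show ?thesis
      proof (cases "\<exists>w\<in>carrier P. b \<sqsubseteq>\<^bsub>P\<^esub> w \<and> v \<sqsubseteq>\<^bsub>P\<^esub> w")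
        case False
        hence "v \<in> B a b" using v by (simp add: B_def)
        thus ?thesis using v(3) by blast
      next
        case True
        then obtain w where w: "w \<in> carrier P" "b \<sqsubseteq>\<^bsub>P\<^esub> w" "v \<sqsubseteq>\<^bsub>P\<^esub> w" by blast
        have "a \<sqsubseteq>\<^bsub>P\<^esub> w" by (rule le_trans[OF v(2) w(3) a v(1) w(1)])
        hence "w \<in> B a b" using w by (simp add: B_def)
        moreover have "u \<sqsubseteq>\<^bsub>P\<^esub> w" by (rule le_trans[OF v(3) w(3) u v(1) w(1)])
        ultimately show ?thesis by blast
      qed
    qed
  qed
  define O' where "O' A = {x \<in> S. c x \<inter> A \<noteq> {}}" for A
  have O': "openin ?X (O' A) \<and> dense_in ?X (O' A)" if A: "cofinal_in P A" for A
  proof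
    show "openin ?X (O' A)"
      unfolding openin_finite_part_topology
    proof (intro conjI ballI)
      show "O' A \<subseteq> S" by (auto simp: O'_def)
      fix x assume "x \<in> O' A"
      then obtain a where "a \<in> c x" "a \<in> A" by (auto simp: O'_def)
      thus "\<exists>F. finite F \<and> F \<subseteq> c x \<and> {y \<in> S. F \<subseteq> c y} \<subseteq> O' A"
        by (intro exI[of _ "{a}"]) (auto simp: O'_def)
    qed
    show "dense_in ?X (O' A)"
      unfolding dense_in_iff
    proof (intro conjI allI impI)
      show "O' A \<subseteq> topspace ?X" by (auto simp: O'_def)
      fix T assume T: "openin ?X T \<and> T \<noteq> {}"
      then obtain x where "x \<in> T" by blast
      then obtain F where F: "finite F" "F \<subseteq> c x" "{y \<in> S. F \<subseteq> c y} \<subseteq> T" and "x \<in> S"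
        using T finite_part_nbhdE[of S c T x] by metis
      obtain u where u: "u \<in> carrier P" "\<forall>x\<in>F. x \<sqsubseteq>\<^bsub>P\<^esub> u"
        using S[OF \<open>x \<in> S\<close>] F(1,2) unfolding upwards_centered_in_def by meson
      have Fc: "F \<subseteq> carrier P" using S[OF \<open>x \<in> S\<close>] F(2) by (auto simp: upwards_centered_in_def)
      obtain a where a: "a \<in> A" "u \<sqsubseteq>\<^bsub>P\<^esub> a" using A u(1) by (auto simp: cofinal_in_def)
      have ac: "a \<in> carrier P" using A a(1) by (auto simp: cofinal_in_def)
      \<comment> \<open>The element a of A above a bound of F can be added to F, because a itself
        bounds the enlarged set.\<close>
      have "\<forall>x\<in>insert a F. x \<sqsubseteq>\<^bsub>P\<^esub> a"
        using le_trans[OF _ a(2) _ u(1) ac] u(2) Fc ac by auto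
      hence "h (insert a F) \<in> S"
        using Fc ac by (intro S' cent[OF _ ac]) auto
      hence "h (insert a F) \<in> O' A \<inter> T"
        using subsetD[OF F(3), of "h (insert a F)"] a(1) by (auto simp: O'_def)
      thus "O' A \<inter> T \<noteq> {}" by blast
    qed
  qed
  \<comment> \<open>The number of these sets is bounded by |J| plus the square of the size of P,
    hence by |J|.\<close>
  moreover define \<D> where "\<D> = O' ` (D ` J \<union> (\<lambda>(a, b). B a b) ` (carrier P \<times> carrier P))"
  moreover have "|\<D>| \<le>o |J|"
  proof -
    have "|(\<lambda>(a, b). B a b) ` (carrier P \<times> carrier P)| \<le>o |carrier P \<times> carrier P|"
      by (rule card_of_image)
    also have "|carrier P \<times> carrier P| \<le>o |J|"
      using infJ assms(2) by (simp add: card_of_Sigma_ordLeq_infinite)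
    finally have "|D ` J \<union> (\<lambda>(a, b). B a b) ` (carrier P \<times> carrier P)| \<le>o |J|"
      using infJ card_of_image[of D J]
      by (intro card_of_Un_ordLeq_infinite_Field card_of_Card_order) (simp_all add: Field_card_of)
    thus ?thesis
      unfolding \<D>_def by (rule ordLeq_transitive[OF card_of_image])
  qed
  moreover have "openin ?X U \<and> dense_in ?X U" if "U \<in> \<D>" for U
    using that O' B_cof unmet_familyD(4)[OF unmet] by (auto simp: \<D>_def)
  moreover have "topspace ?X \<inter> \<Inter>\<D> = {}"
  proof (rule ccontr)
    assume "topspace ?X \<inter> \<Inter>\<D> \<noteq> {}"
    then obtain x where x: "x \<in> S" "x \<in> \<Inter>\<D>" by auto
    let ?C = "c x"
    have Cc: "?C \<subseteq> carrier P" using S[OF x(1)] by (simp add: upwards_centered_in_def)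
    have CD: "?C \<inter> D j \<noteq> {}" if "j \<in> J" for j
      using x(2) that by (auto simp: \<D>_def O'_def)
    have CB: "?C \<inter> B a b \<noteq> {}" if "a \<in> carrier P" "b \<in> carrier P" for a b
      using x(2) that by (auto simp: \<D>_def O'_def)
    have compat: "\<exists>u\<in>carrier P. a \<sqsubseteq>\<^bsub>P\<^esub> u \<and> b \<sqsubseteq>\<^bsub>P\<^esub> u" if "a \<in> ?C" "b \<in> ?C" for a b
      using S[OF x(1)] that unfolding upwards_centered_in_def
      by (elim conjE allE[of _ "{a, b}"]) auto
    have "directed_in P ?C"
      unfolding directed_in_def
    proof (intro conjI ballI Cc)
      obtain j where "j \<in> J" using infJ by (metis finite.emptyI ex_in_conv)
      thus "?C \<noteq> {}" using CD by blast
      fix a b assume ab: "a \<in> ?C" "b \<in> ?C"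
      then obtain z where z: "z \<in> ?C" "z \<in> B a b" using CB[of a b] Cc by blast
      thus "\<exists>z\<in>?C. a \<sqsubseteq>\<^bsub>P\<^esub> z \<and> b \<sqsubseteq>\<^bsub>P\<^esub> z"
        using compat[OF ab(1) z(1)] compat[OF ab(2) z(1)] by (auto simp: B_def)
    qed
    then obtain j where "j \<in> J" "?C \<inter> D j = {}" using unmet_familyD(5)[OF unmet] by blast
    thus False using CD by blast
  qed
  ultimately show thesis using that[of ?X \<D>] by blast
qed

subsection \<open>The lattice of upper sets\<close>

text \<open>The injection \<open>h\<close> codes sets of elements of P in \<open>'l\<close>, the
  type on which the lattice has to be carried.\<close>

locale up_set_lattice = partial_order P for P :: "'q gorder" (structure) +
  fixes h :: "'q set \<Rightarrow> 'l"
  assumes inj_h: "inj h"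
begin

definition up_sets :: "'q set set" where
  "up_sets = {U. U \<subseteq> carrier P \<and> (\<forall>x\<in>U. \<forall>y\<in>carrier P. x \<sqsubseteq> y \<longrightarrow> y \<in> U)}"

definition up_closure :: "'q set \<Rightarrow> 'q set" where
  "up_closure A = {z \<in> carrier P. \<exists>a\<in>A. a \<sqsubseteq> z}"

definition k :: "'l \<Rightarrow> 'q set" where
  "k = inv h"

definition L :: "'l gorder" where
  "L = \<lparr>carrier = h ` up_sets, eq = (=), le = (\<lambda>x y. k x \<subseteq> k y)\<rparr>"

lemma L_sel: "carrier L = h ` up_sets" "eq L = (=)" "le L = (\<lambda>x y. k x \<subseteq> k y)"
  by (simp_all add: L_def)

lemma k_h [simp]: "k (h U) = U"
  by (simp add: k_def inj_h)

lemma carrier_L: "x \<in> carrier L \<longleftrightarrow> k x \<in> up_sets \<and> h (k x) = x"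
proof
  show "x \<in> carrier L \<Longrightarrow> k x \<in> up_sets \<and> h (k x) = x"
    by (auto simp: L_sel)
  assume "k x \<in> up_sets \<and> h (k x) = x"
  thus "x \<in> carrier L"
    unfolding L_sel by (metis imageI)
qed

lemma h_carrier: "U \<in> up_sets \<Longrightarrow> h U \<in> carrier L"
  by (simp add: L_sel)

lemma Union_up_sets: "\<A> \<subseteq> up_sets \<Longrightarrow> \<Union>\<A> \<in> up_sets"
  unfolding up_sets_def by blast

text \<open>The factor \<open>carrier P\<close> gives the empty family the correct infimum, the top
  element.\<close>

lemma Inter_up_sets: "\<A> \<subseteq> up_sets \<Longrightarrow> carrier P \<inter> \<Inter>\<A> \<in> up_sets"
  unfolding up_sets_def by blast

lemma up_closure_up_sets:
  assumes "A \<subseteq> carrier P"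
  shows "up_closure A \<in> up_sets"
  unfolding up_sets_def mem_Collect_eq
proof (intro conjI ballI impI)
  fix x y assume "x \<in> up_closure A" "y \<in> carrier P" "x \<sqsubseteq> y"
  then obtain a where "a \<in> A" "a \<sqsubseteq> x" "x \<in> carrier P" by (auto simp: up_closure_def)
  moreover from this have "a \<sqsubseteq> y"
    using le_trans[of a x y] assms \<open>x \<sqsubseteq> y\<close> \<open>y \<in> carrier P\<close> by auto
  ultimately show "y \<in> up_closure A"
    using \<open>y \<in> carrier P\<close> by (auto simp: up_closure_def)
qed (auto simp: up_closure_def)

lemma up_closure_subset: "U \<in> up_sets \<Longrightarrow> A \<subseteq> U \<Longrightarrow> up_closure A \<subseteq> U"
  unfolding up_sets_def up_closure_def by blast

lemma subset_up_closure: "A \<subseteq> carrier P \<Longrightarrow> A \<subseteq> up_closure A"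
  unfolding up_closure_def by (intro subsetI CollectI conjI bexI le_refl) auto

lemma partial_order_L: "partial_order L"
proof unfold_locales
  fix x y assume xy: "x \<sqsubseteq>\<^bsub>L\<^esub> y" "y \<sqsubseteq>\<^bsub>L\<^esub> x" "x \<in> carrier L" "y \<in> carrier L"
  hence "k x = k y" unfolding L_sel(3) by blast
  moreover have "h (k x) = x" "h (k y) = y" using xy(3,4) carrier_L by blast+
  ultimately show "x .=\<^bsub>L\<^esub> y" unfolding L_sel(2) by metis
qed (simp_all add: L_sel(2,3))

lemma least_Upper:
  assumes "A \<subseteq> carrier L"
  shows "least L (h (\<Union>(k ` A))) (Upper L A)"
  unfolding least_def
proof (intro conjI ballI)
  have "k ` A \<subseteq> up_sets" using assms carrier_L by blast
  hence "h (\<Union>(k ` A)) \<in> carrier L" by (intro h_carrier Union_up_sets)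
  thus "h (\<Union>(k ` A)) \<in> Upper L A"
    unfolding Upper_def L_sel(3) by auto
  fix u assume u: "u \<in> Upper L A"
  have "k x \<subseteq> k u" if "x \<in> A" for x
    using u that subsetD[OF assms that] unfolding Upper_def L_sel(3) by simp
  thus "h (\<Union>(k ` A)) \<sqsubseteq>\<^bsub>L\<^esub> u"
    unfolding L_sel(3) by auto
qed simp

lemma greatest_Lower:
  assumes "A \<subseteq> carrier L"
  shows "greatest L (h (carrier P \<inter> \<Inter>(k ` A))) (Lower L A)"
  unfolding greatest_def
proof (intro conjI ballI)
  have "k ` A \<subseteq> up_sets" using assms carrier_L by blast
  hence "h (carrier P \<inter> \<Inter>(k ` A)) \<in> carrier L" by (intro h_carrier Inter_up_sets)
  thus "h (carrier P \<inter> \<Inter>(k ` A)) \<in> Lower L A"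
    unfolding Lower_def L_sel(3) by auto
  fix u assume u: "u \<in> Lower L A"
  hence "u \<in> carrier L" by (simp add: Lower_def)
  hence "k u \<subseteq> carrier P" using carrier_L by (simp add: up_sets_def)
  moreover have "k u \<subseteq> k x" if "x \<in> A" for x
    using u that subsetD[OF assms that] unfolding Lower_def L_sel(3) by simp
  ultimately show "u \<sqsubseteq>\<^bsub>L\<^esub> h (carrier P \<inter> \<Inter>(k ` A))"
    unfolding L_sel(3) by auto
qed simp

lemma complete_lattice_L: "complete_lattice L"
proof -
  interpret L: partial_order L by (rule partial_order_L)
  show ?thesis
  proof (rule L.complete_latticeI)
    fix A assume A: "A \<subseteq> carrier L"
    show "\<exists>s. least L s (Upper L A)" using least_Upper[OF A] by blast
    show "\<exists>i. greatest L i (Lower L A)" using greatest_Lower[OF A] by blast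
  qed
qed

sublocale L: complete_lattice L
  by (rule complete_lattice_L)

lemma join_L:
  assumes "x \<in> carrier L" "y \<in> carrier L"
  shows "x \<squnion>\<^bsub>L\<^esub> y = h (k x \<union> k y)"
proof -
  have *: "least L (h (k x \<union> k y)) (Upper L {x, y})"
    using least_Upper[of "{x, y}"] assms by simp
  show ?thesis
    unfolding join_def sup_def by (rule some_equality, rule *, rule L.least_unique[OF _ *])
qed

lemma meet_L:
  assumes "x \<in> carrier L" "y \<in> carrier L"
  shows "x \<sqinter>\<^bsub>L\<^esub> y = h (k x \<inter> k y)"
proof -
  have "k x \<subseteq> carrier P" using assms carrier_L by (auto simp: up_sets_def)
  hence "carrier P \<inter> (k x \<inter> k y) = k x \<inter> k y" by blast
  hence *: "greatest L (h (k x \<inter> k y)) (Lower L {x, y})"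
    using greatest_Lower[of "{x, y}"] assms by simp
  show ?thesis
    unfolding meet_def inf_def by (rule some_equality, rule *, rule L.greatest_unique[OF _ *])
qed

lemma bottom_L: "\<bottom>\<^bsub>L\<^esub> = h {}"
proof -
  have "h {} \<in> carrier L" by (intro h_carrier) (simp add: up_sets_def)
  hence "k \<bottom>\<^bsub>L\<^esub> = {}" using L.bottom_lower[of "h {}"] by (simp add: L_sel(3))
  moreover have "h (k \<bottom>\<^bsub>L\<^esub>) = \<bottom>\<^bsub>L\<^esub>" using L.bottom_closed carrier_L by blast
  ultimately show ?thesis by simp
qed

lemma top_L: "\<top>\<^bsub>L\<^esub> = h (carrier P)"
proof -
  have "h (carrier P) \<in> carrier L" by (intro h_carrier) (simp add: up_sets_def)
  hence "carrier P \<subseteq> k \<top>\<^bsub>L\<^esub>" using L.top_higher[of "h (carrier P)"] by (simp add: L_sel(3))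
  moreover have t: "k \<top>\<^bsub>L\<^esub> \<in> up_sets" "h (k \<top>\<^bsub>L\<^esub>) = \<top>\<^bsub>L\<^esub>" using L.top_closed carrier_L by blast+
  ultimately have "k \<top>\<^bsub>L\<^esub> = carrier P" by (auto simp: up_sets_def)
  thus ?thesis using t(2) by simp
qed

lemma distributive_L: "distributive_in L"
  unfolding distributive_in_def
proof (intro ballI conjI)
  fix a b c assume "a \<in> carrier L" "b \<in> carrier L" "c \<in> carrier L"
  thus "a \<sqinter>\<^bsub>L\<^esub> (b \<squnion>\<^bsub>L\<^esub> c) = (a \<sqinter>\<^bsub>L\<^esub> b) \<squnion>\<^bsub>L\<^esub> (a \<sqinter>\<^bsub>L\<^esub> c)"
    using L.join_closed[of b c] L.meet_closed[of a b] L.meet_closed[of a c]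
    by (simp add: join_L meet_L Int_Un_distrib)
next
  fix a b c assume "a \<in> carrier L" "b \<in> carrier L" "c \<in> carrier L"
  thus "a \<squnion>\<^bsub>L\<^esub> (b \<sqinter>\<^bsub>L\<^esub> c) = (a \<squnion>\<^bsub>L\<^esub> b) \<sqinter>\<^bsub>L\<^esub> (a \<squnion>\<^bsub>L\<^esub> c)"
    using L.meet_closed[of b c] L.join_closed[of a b] L.join_closed[of a c]
    by (simp add: join_L meet_L Un_Int_distrib)
qed

section \<open>Continuity of the lattice of upper sets\<close>

text \<open>Suprema are unions, so p already lies in some member of E, and an upper set containing p
  contains everything above it.\<close>

lemma way_below_principal:
  assumes "y \<in> carrier L" "p \<in> k y"
  shows "way_below_in L (h (up_closure {p})) y"
  unfolding way_below_in_def
proof (intro allI impI)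
  fix E s assume E: "directed_in L E \<and> least L s (Upper L E) \<and> y \<sqsubseteq>\<^bsub>L\<^esub> s"
  hence Ec: "E \<subseteq> carrier L" by (simp add: directed_in_def)
  have "s = h (\<Union>(k ` E))" using L.least_unique least_Upper[OF Ec] E by blast
  hence "k y \<subseteq> \<Union>(k ` E)" using E by (simp add: L_sel(3))
  then obtain e where e: "e \<in> E" "p \<in> k e" using assms(2) by blast
  hence "up_closure {p} \<subseteq> k e" using Ec carrier_L by (intro up_closure_subset) auto
  thus "\<exists>e\<in>E. h (up_closure {p}) \<sqsubseteq>\<^bsub>L\<^esub> e" using e(1) by (auto simp: L_sel(3))
qed

text \<open>Every upper set is the union of its principal upper sets, all of which are way below it;
  joins make the way-below set directed.\<close>

lemma upwards_continuous_L: "upwards_continuous L"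
  unfolding upwards_continuous_def
proof (intro ballI conjI)
  fix y assume y: "y \<in> carrier L"
  let ?W = "{x \<in> carrier L. way_below_in L x y}"
  show "directed_in L ?W"
    unfolding directed_in_def
  proof (intro conjI ballI)
    have "way_below_in L \<bottom>\<^bsub>L\<^esub> y"
      unfolding way_below_in_def directed_in_def using L.bottom_lower by blast
    thus "?W \<noteq> {}" using L.bottom_closed by blast
    fix a b assume "a \<in> ?W" "b \<in> ?W"
    hence ab: "a \<in> carrier L" "way_below_in L a y" "b \<in> carrier L" "way_below_in L b y" by auto
    have "way_below_in L (a \<squnion>\<^bsub>L\<^esub> b) y"
      unfolding way_below_in_def
    proof (intro allI impI)
      fix E s assume E: "directed_in L E \<and> least L s (Upper L E) \<and> y \<sqsubseteq>\<^bsub>L\<^esub> s"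
      then obtain e f where e: "e \<in> E" "a \<sqsubseteq>\<^bsub>L\<^esub> e" and f: "f \<in> E" "b \<sqsubseteq>\<^bsub>L\<^esub> f"
        using ab(2,4) unfolding way_below_in_def by meson
      obtain g where g: "g \<in> E" "e \<sqsubseteq>\<^bsub>L\<^esub> g" "f \<sqsubseteq>\<^bsub>L\<^esub> g"
        using E e(1) f(1) unfolding directed_in_def by meson
      have "k a \<union> k b \<subseteq> k g" using e f g by (auto simp: L_sel(3))
      hence "a \<squnion>\<^bsub>L\<^esub> b \<sqsubseteq>\<^bsub>L\<^esub> g" using ab by (simp add: join_L L_sel(3))
      thus "\<exists>e\<in>E. a \<squnion>\<^bsub>L\<^esub> b \<sqsubseteq>\<^bsub>L\<^esub> e" using g(1) by blast
    qed
    thus "\<exists>z\<in>?W. a \<sqsubseteq>\<^bsub>L\<^esub> z \<and> b \<sqsubseteq>\<^bsub>L\<^esub> z"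
      using ab L.join_left[of a b] L.join_right[of a b] by (intro bexI[of _ "a \<squnion>\<^bsub>L\<^esub> b"]) auto
  qed auto
  have le: "x \<sqsubseteq>\<^bsub>L\<^esub> y" if "way_below_in L x y" for x
  proof -
    have "directed_in L {y}" "least L y (Upper L {y})"
      using y by (auto simp: directed_in_def least_def Upper_def L_sel(3))
    hence "\<exists>e\<in>{y}. x \<sqsubseteq>\<^bsub>L\<^esub> e"
      using that L.le_refl[OF y] unfolding way_below_in_def by meson
    thus ?thesis by simp
  qed
  show "least L y (Upper L ?W)"
    unfolding least_def
  proof (intro conjI ballI)
    show "y \<in> Upper L ?W" using y le by (auto simp: Upper_def)
    fix u assume u: "u \<in> Upper L ?W"
    have "p \<in> k u" if p: "p \<in> k y" for p
    proof -
      have pc: "p \<in> carrier P" using y p carrier_L by (auto simp: up_sets_def)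
      have "h (up_closure {p}) \<in> ?W"
        using way_below_principal[OF y p] h_carrier up_closure_up_sets[of "{p}"] pc by simp
      hence "h (up_closure {p}) \<sqsubseteq>\<^bsub>L\<^esub> u" using u by (simp add: Upper_def)
      thus ?thesis using subset_up_closure[of "{p}"] pc by (auto simp: L_sel(3))
    qed
    thus "y \<sqsubseteq>\<^bsub>L\<^esub> u" by (auto simp: L_sel(3))
  qed simp
qed

section \<open>Centeredness, non-zero divisors and irreducible upper sets\<close>

text \<open>A centered R of P yields the upper sets meeting R. Choosing a point of R in each of
  finitely many, an upper bound of these points generates a non-empty upper set inside all of
  them.\<close>

lemma downwards_sigma_centered_L:
  assumes "upwards_sigma_centered P"
  shows "downwards_sigma_centered L"
proof -
  obtain \<R> where \<R>: "countable \<R>" "\<And>R. R \<in> \<R> \<Longrightarrow> upwards_centered_in P R" "\<Union>\<R> = carrier P"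
    by (rule upwards_sigma_centeredE[OF assms]) (rule that)
  let ?Q = "carrier L - {\<bottom>\<^bsub>L\<^esub>}"
  let ?f = "\<lambda>R. {x \<in> ?Q. k x \<inter> R \<noteq> {}}"
  let ?I = "inv_gorder (L\<lparr>carrier := ?Q\<rparr>)"
  have Un: "\<Union>(?f ` \<R>) = ?Q"
  proof (rule subset_antisym; rule subsetI)
    fix x assume x: "x \<in> ?Q"
    hence "k x \<noteq> {}" using carrier_L by (auto simp: bottom_L)
    then obtain a where "a \<in> k x" by blast
    moreover have "k x \<subseteq> carrier P" using x carrier_L by (auto simp: up_sets_def)
    ultimately obtain R where "R \<in> \<R>" "a \<in> R" using \<R>(3) by blast
    thus "x \<in> \<Union>(?f ` \<R>)" using x \<open>a \<in> k x\<close> by blast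
  qed auto
  have "upwards_centered_in ?I (?f R)" if R: "R \<in> \<R>" for R
    unfolding upwards_centered_in_def
  proof (intro conjI allI impI)
    show "?f R \<subseteq> carrier ?I" by auto
    have Rc: "R \<subseteq> carrier P" using R \<R>(3) by blast
    fix F assume F: "finite F \<and> F \<subseteq> ?f R"
    hence "\<forall>x\<in>F. \<exists>a. a \<in> k x \<and> a \<in> R" by auto
    then obtain a where a: "\<forall>x\<in>F. a x \<in> k x \<and> a x \<in> R" by metis
    have "finite (a ` F)" "a ` F \<subseteq> R" using F a by auto
    then obtain u where u: "u \<in> carrier P" "\<forall>z\<in>a ` F. z \<sqsubseteq> u"
      using \<R>(2)[OF R] unfolding upwards_centered_in_def by meson
    have uc: "h (up_closure {u}) \<in> ?Q"
      using h_carrier up_closure_up_sets[of "{u}"] subset_up_closure[of "{u}"] u(1) inj_h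
      by (auto simp: bottom_L inj_eq)
    have "up_closure {u} \<subseteq> k x" if x: "x \<in> F" for x
    proof (rule up_closure_subset)
      show xu: "k x \<in> up_sets" using x F carrier_L by auto
      have "a x \<in> k x" "a x \<sqsubseteq> u" using a u(2) x by auto
      thus "{u} \<subseteq> k x" using xu u(1) unfolding up_sets_def by blast
    qed
    thus "\<exists>u\<in>carrier ?I. \<forall>x\<in>F. x \<sqsubseteq>\<^bsub>?I\<^esub> u"
      using uc by (intro bexI[of _ "h (up_closure {u})"]) (auto simp: L_sel(3))
  qed
  thus ?thesis
    unfolding downwards_sigma_centered_def upwards_sigma_centered_def
    using \<R>(1) Un by (intro exI[of _ "?f ` \<R>"]) auto
qed

text \<open>A non-empty upper set contains, with any of its points, a member of D above that
  point.\<close>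

lemma non_zero_divisor_L:
  assumes "cofinal_in P D"
  shows "non_zero_divisor L (h (up_closure D))"
  unfolding non_zero_divisor_def
proof (intro conjI ballI impI)
  have Dc: "D \<subseteq> carrier P" using assms by (simp add: cofinal_in_def)
  show c: "h (up_closure D) \<in> carrier L" by (intro h_carrier up_closure_up_sets Dc)
  fix y assume y: "y \<in> carrier L" "y \<noteq> \<bottom>\<^bsub>L\<^esub>"
  have up: "k y \<in> up_sets" using y(1) carrier_L by blast
  have "k y \<noteq> {}" using y carrier_L by (auto simp: bottom_L)
  then obtain a where a: "a \<in> k y" by blast
  moreover have "a \<in> carrier P" using a up by (auto simp: up_sets_def)
  ultimately obtain d where d: "d \<in> D" "a \<sqsubseteq> d" using assms by (auto simp: cofinal_in_def)
  have "d \<in> k y" using up a d Dc unfolding up_sets_def by blast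
  moreover have "d \<in> up_closure D" using subset_up_closure[OF Dc] d(1) by blast
  ultimately have "up_closure D \<inter> k y \<noteq> {}" by blast
  thus "h (up_closure D) \<sqinter>\<^bsub>L\<^esub> y \<noteq> \<bottom>\<^bsub>L\<^esub>"
    using inj_h by (simp add: meet_L[OF c y(1)] bottom_L inj_eq)
qed

text \<open>If x and y had no common upper bound outside p, their principal upper sets would meet
  only inside p. Adding each of them to p would then write p as a meet of two strictly larger upper
  sets.\<close>

lemma directed_complement:
  assumes "irreducible_element L p" "k p \<noteq> carrier P"
  shows "directed_in P (carrier P - k p)"
  unfolding directed_in_def
proof (intro conjI ballI)
  have p: "p \<in> carrier L" "k p \<in> up_sets"
    using assms(1) carrier_L by (auto simp: irreducible_element_def)
  show "carrier P - k p \<noteq> {}" using assms(2) p(2) by (auto simp: up_sets_def)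
  fix x y assume xy: "x \<in> carrier P - k p" "y \<in> carrier P - k p"
  show "\<exists>z\<in>carrier P - k p. x \<sqsubseteq> z \<and> y \<sqsubseteq> z"
  proof (rule ccontr)
    assume no: "\<not> ?thesis"
    have sub: "up_closure {x} \<inter> up_closure {y} \<subseteq> k p"
      using no by (auto simp: up_closure_def)
    let ?a = "k p \<union> up_closure {x}" and ?b = "k p \<union> up_closure {y}"
    have "?a \<in> up_sets" "?b \<in> up_sets"
      using Union_up_sets[of "{k p, up_closure {x}}"] Union_up_sets[of "{k p, up_closure {y}}"]
        p(2) up_closure_up_sets[of "{x}"] up_closure_up_sets[of "{y}"] xy by auto
    hence c: "h ?a \<in> carrier L" "h ?b \<in> carrier L" by (simp_all add: h_carrier)
    have "?a \<inter> ?b = k p" using sub by blast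
    hence "p = h ?a \<sqinter>\<^bsub>L\<^esub> h ?b" using p(1) carrier_L by (simp add: meet_L[OF c])
    hence "p = h ?a \<or> p = h ?b" using assms(1) c unfolding irreducible_element_def by blast
    hence "k p = ?a \<or> k p = ?b" by (metis k_h)
    thus False
      using subset_up_closure[of "{x}"] subset_up_closure[of "{y}"] xy by blast
  qed
qed auto

end

text \<open>The divisors are the upper closures of the cofinal sets. An irreducible p above none of
  them would have a directed complement meeting every \<open>D j\<close>.\<close>

lemma lattice_counterexample:
  fixes P :: "'q gorder" and J :: "'j set" and h :: "'q set \<Rightarrow> 'l"
  assumes unmet: "unmet_family P J D" and "inj h"
  obtains L :: "'l gorder" and \<D> where "complete_lattice L" "\<bottom>\<^bsub>L\<^esub> \<noteq> \<top>\<^bsub>L\<^esub>" "distributive_in L"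
    "upwards_continuous L" "downwards_sigma_centered L" "|\<D>| \<le>o |J|"
    "\<And>d. d \<in> \<D> \<Longrightarrow> non_zero_divisor L d"
    "\<And>p. irreducible_element L p \<Longrightarrow> \<exists>d\<in>\<D>. d \<sqsubseteq>\<^bsub>L\<^esub> p"
proof -
  interpret up_set_lattice P h
    using unmet_familyD(1)[OF unmet] assms(2)
    by (simp add: up_set_lattice_def up_set_lattice_axioms_def)
  let ?\<D> = "(\<lambda>j. h (up_closure (D j))) ` J"
  have cof: "\<And>j. j \<in> J \<Longrightarrow> cofinal_in P (D j)" by (rule unmet_familyD(4)[OF unmet])
  have "\<exists>d\<in>?\<D>. d \<sqsubseteq>\<^bsub>L\<^esub> p" if p: "irreducible_element L p" for p
  proof (rule ccontr)
    assume "\<not> (\<exists>d\<in>?\<D>. d \<sqsubseteq>\<^bsub>L\<^esub> p)"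
    hence no: "\<not> up_closure (D j) \<subseteq> k p" if "j \<in> J" for j using that by (simp add: L_sel(3))
    have pu: "k p \<in> up_sets" using p carrier_L by (auto simp: irreducible_element_def)
    have meet: "(carrier P - k p) \<inter> D j \<noteq> {}" if j: "j \<in> J" for j
    proof -
      have "D j \<subseteq> carrier P" using cof[OF j] by (simp add: cofinal_in_def)
      moreover have "\<not> D j \<subseteq> k p" using no[OF j] up_closure_subset[OF pu] by blast
      ultimately show ?thesis by blast
    qed
    obtain j where "j \<in> J" using unmet_family_infinite[OF unmet] by (metis finite.emptyI ex_in_conv)
    hence "k p \<noteq> carrier P" using meet by blast
    hence "directed_in P (carrier P - k p)" by (rule directed_complement[OF p])
    then obtain j where "j \<in> J" "(carrier P - k p) \<inter> D j = {}"
      using unmet_familyD(5)[OF unmet] by blast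
    thus False using meet by blast
  qed
  moreover have "\<bottom>\<^bsub>L\<^esub> \<noteq> \<top>\<^bsub>L\<^esub>"
    using unmet_familyD(2)[OF unmet] inj_h by (simp add: bottom_L top_L inj_eq)
  moreover have "\<And>d. d \<in> ?\<D> \<Longrightarrow> non_zero_divisor L d"
    using cof non_zero_divisor_L by blast
  ultimately show thesis
    using that[of L ?\<D>] complete_lattice_L distributive_L upwards_continuous_L
      downwards_sigma_centered_L[OF unmet_familyD(3)[OF unmet]] card_of_image by blast
qed

subsection \<open>The equivalence\<close>

text \<open>The degenerate structures are excluded because they would falsify the statements: an
  empty space has no point and no irreducible set, and in a one-element lattice the only element is
  a non-zero divisor below itself. The factor \<open>topspace X\<close> gives the empty family of
  dense sets its intended intersection.\<close>

theorem proposition2: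
  fixes \<kappa> :: "'k rel"
  assumes "Card_order \<kappa>"
    and "large_type TYPE('p)" and "large_type TYPE('a)" and "large_type TYPE('l)"
  shows
    "(\<kappa> <o cardinal_p TYPE('p) \<longleftrightarrow>
        (\<forall>X :: 'a topology. topspace X \<noteq> {} \<and>
           separable_space X \<and> locally_compact_base_space X \<and> sober_space X \<longrightarrow>
           (\<forall>\<D>. |\<D>| \<le>o \<kappa> \<and> (\<forall>U\<in>\<D>. openin X U \<and> dense_in X U) \<longrightarrow>
              topspace X \<inter> \<Inter>\<D> \<noteq> {}))) \<and>
     (\<kappa> <o cardinal_p TYPE('p) \<longleftrightarrow>
        (\<forall>X :: 'a topology. topspace X \<noteq> {} \<and>
           separable_space X \<and> core_compact_space X \<longrightarrow>
           (\<forall>\<D>. |\<D>| \<le>o \<kappa> \<and> (\<forall>U\<in>\<D>. openin X U \<and> dense_in X U) \<longrightarrow>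
              (\<exists>C. irreducible_in X C \<and> (\<forall>U\<in>\<D>. C \<inter> U \<noteq> {}))))) \<and>
     (\<kappa> <o cardinal_p TYPE('p) \<longleftrightarrow>
        (\<forall>X :: 'a topology. topspace X \<noteq> {} \<and>
           sigma_centered_space X \<and> locally_compact_base_space X \<and> sober_space X \<longrightarrow>
           (\<forall>\<D>. |\<D>| \<le>o \<kappa> \<and> (\<forall>U\<in>\<D>. openin X U \<and> dense_in X U) \<longrightarrow>
              topspace X \<inter> \<Inter>\<D> \<noteq> {}))) \<and>
     (\<kappa> <o cardinal_p TYPE('p) \<longleftrightarrow>
        (\<forall>X :: 'a topology. topspace X \<noteq> {} \<and>
           sigma_centered_space X \<and> core_compact_space X \<longrightarrow>
           (\<forall>\<D>. |\<D>| \<le>o \<kappa> \<and> (\<forall>U\<in>\<D>. openin X U \<and> dense_in X U) \<longrightarrow>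
              (\<exists>C. irreducible_in X C \<and> (\<forall>U\<in>\<D>. C \<inter> U \<noteq> {}))))) \<and>
     (\<kappa> <o cardinal_p TYPE('p) \<longleftrightarrow>
        (\<forall>L :: 'l gorder. complete_lattice L \<and> \<bottom>\<^bsub>L\<^esub> \<noteq> \<top>\<^bsub>L\<^esub> \<and> distributive_in L \<and>
           upwards_continuous L \<and> downwards_sigma_centered L \<longrightarrow>
           (\<forall>D. |D| \<le>o \<kappa> \<and> (\<forall>d\<in>D. non_zero_divisor L d) \<longrightarrow>
              (\<exists>p. irreducible_element L p \<and> \<not> (\<exists>d\<in>D. d \<sqsubseteq>\<^bsub>L\<^esub> p)))))"
    (is "(?S1 \<longleftrightarrow> ?S2) \<and> (_ \<longleftrightarrow> ?S3) \<and> (_ \<longleftrightarrow> ?S4) \<and> (_ \<longleftrightarrow> ?S5) \<and> (_ \<longleftrightarrow> ?S6)")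
proof -
  have S15: ?S5 if less: ?S1
  proof (intro allI impI)
    fix X :: "'a topology" and \<D>
    assume X: "topspace X \<noteq> {} \<and> sigma_centered_space X \<and> core_compact_space X"
      and \<D>: "|\<D>| \<le>o \<kappa> \<and> (\<forall>U\<in>\<D>. openin X U \<and> dense_in X U)"
    have "|\<D>| <o cardinal_p TYPE('p)" using \<D> less ordLeq_ordLess_trans by blast
    then obtain C where "irreducible_in X C" "\<And>U. U \<in> \<D> \<Longrightarrow> C \<inter> U \<noteq> {}"
      using core_compact_baire[OF assms(2), of \<D> X] X \<D> by metis
    thus "\<exists>C. irreducible_in X C \<and> (\<forall>U\<in>\<D>. C \<inter> U \<noteq> {})" by blast
  qed
  have S53: ?S3 if s: ?S5
  proof (intro allI impI)
    fix X :: "'a topology" and \<D>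
    assume "topspace X \<noteq> {} \<and> separable_space X \<and> core_compact_space X"
    hence "topspace X \<noteq> {} \<and> sigma_centered_space X \<and> core_compact_space X"
      using separable_imp_sigma_centered_space by blast
    moreover assume "|\<D>| \<le>o \<kappa> \<and> (\<forall>U\<in>\<D>. openin X U \<and> dense_in X U)"
    ultimately show "\<exists>C. irreducible_in X C \<and> (\<forall>U\<in>\<D>. C \<inter> U \<noteq> {})"
      by (rule s[rule_format])
  qed
  have S54: ?S4 if s: ?S5
  proof (intro allI impI)
    fix X :: "'a topology" and \<D>
    assume X: "topspace X \<noteq> {} \<and> sigma_centered_space X \<and> locally_compact_base_space X \<and> sober_space X"
    hence "topspace X \<noteq> {} \<and> sigma_centered_space X \<and> core_compact_space X"
      using locally_compact_base_imp_core_compact_space by blast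
    moreover assume \<D>: "|\<D>| \<le>o \<kappa> \<and> (\<forall>U\<in>\<D>. openin X U \<and> dense_in X U)"
    ultimately have "\<exists>C. irreducible_in X C \<and> (\<forall>U\<in>\<D>. C \<inter> U \<noteq> {})"
      by (rule s[rule_format])
    then obtain C where C: "irreducible_in X C" "\<And>U. U \<in> \<D> \<Longrightarrow> openin X U \<and> C \<inter> U \<noteq> {}"
      using \<D> by blast
    show "topspace X \<inter> \<Inter>\<D> \<noteq> {}"
      by (rule irreducible_meets_imp_Inter_nonempty[OF _ C]) (use X in blast)
  qed
  have S32: ?S2 if s: ?S3
  proof (intro allI impI)
    fix X :: "'a topology" and \<D>
    assume X: "topspace X \<noteq> {} \<and> separable_space X \<and> locally_compact_base_space X \<and> sober_space X"
    hence "topspace X \<noteq> {} \<and> separable_space X \<and> core_compact_space X"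
      using locally_compact_base_imp_core_compact_space by blast
    moreover assume \<D>: "|\<D>| \<le>o \<kappa> \<and> (\<forall>U\<in>\<D>. openin X U \<and> dense_in X U)"
    ultimately have "\<exists>C. irreducible_in X C \<and> (\<forall>U\<in>\<D>. C \<inter> U \<noteq> {})"
      by (rule s[rule_format])
    then obtain C where C: "irreducible_in X C" "\<And>U. U \<in> \<D> \<Longrightarrow> openin X U \<and> C \<inter> U \<noteq> {}"
      using \<D> by blast
    show "topspace X \<inter> \<Inter>\<D> \<noteq> {}"
      by (rule irreducible_meets_imp_Inter_nonempty[OF _ C]) (use X in blast)
  qed
  have S42: ?S2 if s: ?S4
  proof (intro allI impI)
    fix X :: "'a topology" and \<D>
    assume "topspace X \<noteq> {} \<and> separable_space X \<and> locally_compact_base_space X \<and> sober_space X"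
    hence "topspace X \<noteq> {} \<and> sigma_centered_space X \<and> locally_compact_base_space X \<and> sober_space X"
      using separable_imp_sigma_centered_space by blast
    moreover assume "|\<D>| \<le>o \<kappa> \<and> (\<forall>U\<in>\<D>. openin X U \<and> dense_in X U)"
    ultimately show "topspace X \<inter> \<Inter>\<D> \<noteq> {}"
      by (rule s[rule_format])
  qed
  have S16: ?S6 if less: ?S1
  proof (intro allI impI)
    fix L :: "'l gorder" and D
    assume L: "complete_lattice L \<and> \<bottom>\<^bsub>L\<^esub> \<noteq> \<top>\<^bsub>L\<^esub> \<and> distributive_in L \<and>
           upwards_continuous L \<and> downwards_sigma_centered L"
      and D: "|D| \<le>o \<kappa> \<and> (\<forall>d\<in>D. non_zero_divisor L d)"
    have "|D| <o cardinal_p TYPE('p)" using D less ordLeq_ordLess_trans by blast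
    then obtain p where "irreducible_element L p" "\<And>d. d \<in> D \<Longrightarrow> \<not> d \<sqsubseteq>\<^bsub>L\<^esub> p"
      using continuous_lattice_baire[OF assms(2), of D L] L D by metis
    thus "\<exists>p. irreducible_element L p \<and> \<not> (\<exists>d\<in>D. d \<sqsubseteq>\<^bsub>L\<^esub> p)" by blast
  qed
  obtain P :: "nat set gorder" and J :: "nat set set" and D where
    P: "unmet_family P J D" "|carrier P| \<le>o |J|" "|J| =o cardinal_p TYPE('p)"
    using cardinal_p_unmet_family[OF assms(2)] by metis
  \<comment> \<open>Cardinals are comparable across types, so when \<open>?S1\<close> fails the
    families produced by the counterexamples are small enough for the other statements to apply to
    them.\<close>
  have J_le: "|J| \<le>o \<kappa>" if "\<not> ?S1"
  proof -
    have "cardinal_p TYPE('p) \<le>o \<kappa>"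
      using that assms(1) cardinal_p_spec(1)[OF assms(2)]
      by (simp add: card_order_on_well_order_on not_ordLess_iff_ordLeq)
    thus ?thesis using P(3) ordIso_ordLeq_trans by blast
  qed
  have S21: ?S1 if s: ?S2
  proof (rule ccontr)
    assume not1: "\<not> ?S1"
    \<comment> \<open>The points code subsets of a poset on \<open>nat set\<close>; this is where
      the bound of 2 to the continuum is spent.\<close>
    obtain h :: "nat set set \<Rightarrow> 'a" where h: "inj h"
      using large_type_nat_set_set[OF assms(3)] by (auto simp: card_of_ordLeq[symmetric])
    obtain X :: "'a topology" and \<D> where X: "topspace X \<noteq> {}" "separable_space X"
      "locally_compact_base_space X" "sober_space X" "|\<D>| \<le>o |J|"
      "\<And>U. U \<in> \<D> \<Longrightarrow> openin X U \<and> dense_in X U" "topspace X \<inter> \<Inter>\<D> = {}"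
      by (rule separable_counterexample[OF P(1,2) h]) (rule that)
    have "|\<D>| \<le>o \<kappa>" by (rule ordLeq_transitive[OF X(5) J_le[OF not1]])
    hence "topspace X \<inter> \<Inter>\<D> \<noteq> {}"
      using s[rule_format, of X \<D>] X(1-4,6) by blast
    thus False using X(7) by blast
  qed
  have S61: ?S1 if s: ?S6
  proof (rule ccontr)
    assume not1: "\<not> ?S1"
    obtain h :: "nat set set \<Rightarrow> 'l" where h: "inj h"
      using large_type_nat_set_set[OF assms(4)] by (auto simp: card_of_ordLeq[symmetric])
    obtain L :: "'l gorder" and \<D> where L: "complete_lattice L" "\<bottom>\<^bsub>L\<^esub> \<noteq> \<top>\<^bsub>L\<^esub>" "distributive_in L"
      "upwards_continuous L" "downwards_sigma_centered L" "|\<D>| \<le>o |J|"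
      "\<And>d. d \<in> \<D> \<Longrightarrow> non_zero_divisor L d"
      "\<And>p. irreducible_element L p \<Longrightarrow> \<exists>d\<in>\<D>. d \<sqsubseteq>\<^bsub>L\<^esub> p"
      by (rule lattice_counterexample[OF P(1) h]) (rule that)
    have "|\<D>| \<le>o \<kappa>" by (rule ordLeq_transitive[OF L(6) J_le[OF not1]])
    hence "\<exists>p. irreducible_element L p \<and> \<not> (\<exists>d\<in>\<D>. d \<sqsubseteq>\<^bsub>L\<^esub> p)"
      using L(1-5,7) by (intro s[rule_format]) simp_all
    thus False using L(8) by blast
  qed
  \<comment> \<open>The spaces give the square from \<open>?S5\<close> through \<open>?S3\<close> or
    \<open>?S4\<close> to \<open>?S2\<close>, closed by \<open>?S1\<close>; the lattices are tied to
    \<open>?S1\<close> separately.\<close>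
  show ?thesis
    using S15 S53 S54 S32 S42 S16 S21 S61 by argo
qed

end
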